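(* Let $\mathcal{S}$ be the (nonempty) set of all two-qubit states $\rho_{AB}$ with $\mathrm{Tr}(\Pi_x^-\rho_{AB})=e_x$, $\mathrm{Tr}(\Pi_y^-\rho_{AB})=e_y$ and $\mathrm{Tr}(\Pi^-\rho_{AB})=e_z$, where $e_x,e_y,e_z$ are the error rates obtained in parameter estimation, and write $e_b=e_z$. Let $p_0,p_1,p_2,p_3$ be the diagonal terms of $\rho_{AB}$ in the Bell basis $\{|\Phi^+\rangle,|\Phi^-\rangle,|\Psi^+\rangle,|\Psi^-\rangle\}$, which for every $\rho_{AB}\in\mathcal{S}$ are determined by $\sum_ip_i=1$, $e_x=p_1+p_3$, $e_y=p_1+p_2$, $e_z=p_2+p_3$. In the symmetric case, the key rate of the six-state QKD protocol is $$K_{six}=\min_{\rho_{AB}\in\mathcal{S}}C(\Phi(\rho_{AB}))-H(e_b)=1-H(\{p_i\}).$$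
   Context: States are density operators on $\mathbb{C}^2\otimes\mathbb{C}^2$; logarithms are base 2; $S(\rho)=-\mathrm{Tr}[\rho\log_2\rho]$; $H(e)=-e\log_2e-(1-e)\log_2(1-e)$ for a number $e$, and $H(\{p_i\})=-\sum_ip_i\log_2p_i$. $|\pm\rangle=(|0\rangle\pm|1\rangle)/\sqrt2$, $|\pm i\rangle=(|0\rangle\pm i|1\rangle)/\sqrt2$. $\Pi^+=|00\rangle\langle00|+|11\rangle\langle11|$, $\Pi^-=|01\rangle\langle01|+|10\rangle\langle10|$, $\Pi_x^-=|{+-}\rangle\langle{+-}|+|{-+}\rangle\langle{-+}|$, $\Pi_y^-=|{+i},{+i}\rangle\langle{+i},{+i}|+|{-i},{-i}\rangle\langle{-i},{-i}|$. Bell states: $|\Phi^{\pm}\rangle=(|00\rangle\pm|11\rangle)/\sqrt2$, $|\Psi^{\pm}\rangle=(|01\rangle\pm|10\rangle)/\sqrt2$. $\Phi(\rho)=\Pi^+\rho\,\Pi^++\Pi^-\rho\,\Pi^-$. $C(\rho)=S(\rho^{\mathrm{diag}})-S(\rho)$ is the relative entropy of coherence in the reference basis $\{|00\rangle,|01\rangle,|10\rangle,|11\rangle\}$, with $\rho^{\mathrm{diag}}$ the diagonal part of $\rho$ in that basis. Key rate. Alice and Bob share i.i.d. copies of an unknown $\rho_{AB}\in\mathcal{S}$ (collective attacks, asymptotic limit) and generate key by measuring in the $Z$ basis $\{|0\rangle,|1\rangle\}$. In the symmetric case (evenly distributed raw key bits) the reconciliation cost is $H(e_b)$. For a state $\rho$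 of $Q=AB$ with purification $|\psi\rangle_{QE}$, let $R(\rho)=S(Q|E)$ be the conditional entropy of the state $\sum_i|i\rangle\langle i|_Q\otimes\langle i|_Q|\psi\rangle\langle\psi|_{QE}|i\rangle_Q$ obtained by measuring $Q$ in the reference basis. With $\rho_{AB}^{\pm}=\Pi^{\pm}\rho_{AB}\Pi^{\pm}/\mathrm{Tr}(\Pi^{\pm}\rho_{AB})$ (terms of zero weight omitted) and $\sigma_x^B$ the bit flip on Bob's qubit, the key rate is $\min_{\rho_{AB}\in\mathcal{S}}\left[(1-e_b)R(\rho_{AB}^+)+e_bR(\sigma_x^B\rho_{AB}^-\sigma_x^B)\right]-H(e_b)$. *)

theory Defs
  imports Complex_Main "Jordan_Normal_Form.Schur_Decomposition"
begin

definition mat_trace :: "complex mat \<Rightarrow> complex" where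
  "mat_trace A = (\<Sum>i<dim_row A. A $$ (i, i))"

text \<open>The basis vector \<open>|i\<rangle> \<otimes> |j\<rangle>\<close> of a product system has index \<open>i * d + j\<close>, where \<open>d\<close> is
  the dimension of the second factor.\<close>

definition tensor_vec :: "complex vec \<Rightarrow> complex vec \<Rightarrow> complex vec" where
  "tensor_vec u v = vec (dim_vec u * dim_vec v) (\<lambda>i. u $ (i div dim_vec v) * v $ (i mod dim_vec v))"

definition tensor_mat :: "complex mat \<Rightarrow> complex mat \<Rightarrow> complex mat" where
  "tensor_mat A B = mat (dim_row A * dim_row B) (dim_col A * dim_col B)
     (\<lambda>(i, j). A $$ (i div dim_row B, j div dim_col B) * B $$ (i mod dim_row B, j mod dim_col B))"

definition ketbra :: "complex vec \<Rightarrow> complex mat" where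
  "ketbra v = mat (dim_vec v) (dim_vec v) (\<lambda>(i, j). v $ i * cnj (v $ j))"

definition density_operator :: "nat \<Rightarrow> complex mat \<Rightarrow> bool" where
  "density_operator n \<rho> \<longleftrightarrow> \<rho> \<in> carrier_mat n n \<and> mat_adjoint \<rho> = \<rho>
     \<and> (\<forall>v\<in>carrier_vec n. Re ((\<rho> *\<^sub>v v) \<bullet>c v) \<ge> 0) \<and> mat_trace \<rho> = 1"

definition spectral_decomposition :: "complex mat \<Rightarrow> complex mat \<Rightarrow> (nat \<Rightarrow> real) \<Rightarrow> bool" where
  "spectral_decomposition A U d \<longleftrightarrow> (let n = dim_row A in
     U \<in> carrier_mat n n \<and> U * mat_adjoint U = 1\<^sub>m n \<and> mat_adjoint U * U = 1\<^sub>m n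
     \<and> A = U * mat_diag n (\<lambda>i. complex_of_real (d i)) * mat_adjoint U)"

text \<open>Functional calculus for Hermitian matrices. The result does not depend on the chosen
  spectral decomposition.\<close>

definition hermitian_fun :: "(real \<Rightarrow> real) \<Rightarrow> complex mat \<Rightarrow> complex mat" where
  "hermitian_fun f A = (THE B. \<exists>U d. spectral_decomposition A U d
     \<and> B = U * mat_diag (dim_row A) (\<lambda>i. complex_of_real (f (d i))) * mat_adjoint U)"

text \<open>Since \<open>log 2 0 = 0\<close> in HOL, zero eigenvalues and zero probabilities contribute nothing to the
  entropies below, in accordance with the convention \<open>0 log 0 = 0\<close>.\<close>

definition vn_entropy :: "complex mat \<Rightarrow> real" where
  "vn_entropy \<rho> = - Re (mat_trace (\<rho> * hermitian_fun (log 2) \<rho>))"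

definition binary_entropy :: "real \<Rightarrow> real" where
  "binary_entropy e = - e * log 2 e - (1 - e) * log 2 (1 - e)"

definition shannon_entropy :: "nat \<Rightarrow> (nat \<Rightarrow> real) \<Rightarrow> real" where
  "shannon_entropy n p = - (\<Sum>i<n. p i * log 2 (p i))"

definition diag_part :: "complex mat \<Rightarrow> complex mat" where
  "diag_part \<rho> = mat_diag (dim_row \<rho>) (\<lambda>i. \<rho> $$ (i, i))"

definition rel_entropy_coherence :: "complex mat \<Rightarrow> real" where
  "rel_entropy_coherence \<rho> = vn_entropy (diag_part \<rho>) - vn_entropy \<rho>"

text \<open>In the following, \<open>n\<close> is the dimension of the first factor \<open>Q\<close> and \<open>m\<close> that of the second
  factor \<open>E\<close>.\<close>

definition trace_out_E :: "nat \<Rightarrow> nat \<Rightarrow> complex mat \<Rightarrow> complex mat" where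
  "trace_out_E n m M = mat n n (\<lambda>(i, j). \<Sum>k<m. M $$ (i * m + k, j * m + k))"

definition trace_out_Q :: "nat \<Rightarrow> nat \<Rightarrow> complex mat \<Rightarrow> complex mat" where
  "trace_out_Q n m M = mat m m (\<lambda>(k, l). \<Sum>i<n. M $$ (i * m + k, i * m + l))"

definition cond_entropy :: "nat \<Rightarrow> nat \<Rightarrow> complex mat \<Rightarrow> real" where
  "cond_entropy n m M = vn_entropy M - vn_entropy (trace_out_Q n m M)"

definition purification :: "nat \<Rightarrow> nat \<Rightarrow> complex mat \<Rightarrow> complex vec \<Rightarrow> bool" where
  "purification n m \<rho> \<psi> \<longleftrightarrow> \<psi> \<in> carrier_vec (n * m) \<and> trace_out_E n m (ketbra \<psi>) = \<rho>"

definition bra_Q :: "nat \<Rightarrow> nat \<Rightarrow> complex vec \<Rightarrow> complex vec" where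
  "bra_Q m i \<psi> = vec m (\<lambda>k. \<psi> $ (i * m + k))"

text \<open>The state \<open>\<Sum>i. |i\<rangle>\<langle>i| \<otimes> \<langle>i|\<psi>\<rangle>\<langle>\<psi>|i\<rangle>\<close> obtained by measuring \<open>Q\<close>. The sum is taken entrywise,
  because matrices of varying dimension do not form a type-class monoid.\<close>

definition measured_state :: "nat \<Rightarrow> nat \<Rightarrow> complex vec \<Rightarrow> complex mat" where
  "measured_state n m \<psi> = mat (n * m) (n * m)
     (\<lambda>rc. \<Sum>i<n. tensor_mat (ketbra (unit_vec n i)) (ketbra (bra_Q m i \<psi>)) $$ rc)"

text \<open>The randomness \<open>S(Q|E)\<close> of the measured state. The definite description ranges over
  purifying systems of every dimension, so it denotes the intended value only if this value is
  the same for all purifications.\<close>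

definition randomness :: "complex mat \<Rightarrow> real" where
  "randomness \<rho> = (THE r. \<exists>m \<psi>. purification (dim_row \<rho>) m \<rho> \<psi>
     \<and> r = cond_entropy (dim_row \<rho>) m (measured_state (dim_row \<rho>) m \<psi>))"

definition ket0 :: "complex vec" where "ket0 = unit_vec 2 0"
definition ket1 :: "complex vec" where "ket1 = unit_vec 2 1"

definition inv_sqrt2 :: complex where "inv_sqrt2 = complex_of_real (1 / sqrt 2)"

definition ket_plus :: "complex vec" where "ket_plus = inv_sqrt2 \<cdot>\<^sub>v (ket0 + ket1)"
definition ket_minus :: "complex vec" where "ket_minus = inv_sqrt2 \<cdot>\<^sub>v (ket0 - ket1)"
definition ket_plus_i :: "complex vec" where "ket_plus_i = inv_sqrt2 \<cdot>\<^sub>v (ket0 + \<i> \<cdot>\<^sub>v ket1)"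
definition ket_minus_i :: "complex vec" where "ket_minus_i = inv_sqrt2 \<cdot>\<^sub>v (ket0 - \<i> \<cdot>\<^sub>v ket1)"

definition Pi_plus :: "complex mat" where
  "Pi_plus = ketbra (tensor_vec ket0 ket0) + ketbra (tensor_vec ket1 ket1)"

definition Pi_minus :: "complex mat" where
  "Pi_minus = ketbra (tensor_vec ket0 ket1) + ketbra (tensor_vec ket1 ket0)"

definition Pi_x_minus :: "complex mat" where
  "Pi_x_minus = ketbra (tensor_vec ket_plus ket_minus) + ketbra (tensor_vec ket_minus ket_plus)"

definition Pi_y_minus :: "complex mat" where
  "Pi_y_minus = ketbra (tensor_vec ket_plus_i ket_plus_i)
     + ketbra (tensor_vec ket_minus_i ket_minus_i)"

definition bell_Phi_plus :: "complex vec" where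
  "bell_Phi_plus = inv_sqrt2 \<cdot>\<^sub>v (tensor_vec ket0 ket0 + tensor_vec ket1 ket1)"

definition bell_Phi_minus :: "complex vec" where
  "bell_Phi_minus = inv_sqrt2 \<cdot>\<^sub>v (tensor_vec ket0 ket0 - tensor_vec ket1 ket1)"

definition bell_Psi_plus :: "complex vec" where
  "bell_Psi_plus = inv_sqrt2 \<cdot>\<^sub>v (tensor_vec ket0 ket1 + tensor_vec ket1 ket0)"

definition bell_Psi_minus :: "complex vec" where
  "bell_Psi_minus = inv_sqrt2 \<cdot>\<^sub>v (tensor_vec ket0 ket1 - tensor_vec ket1 ket0)"

definition bell_basis :: "complex vec list" where
  "bell_basis = [bell_Phi_plus, bell_Phi_minus, bell_Psi_plus, bell_Psi_minus]"

definition bell_diag :: "complex mat \<Rightarrow> nat \<Rightarrow> real" where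
  "bell_diag \<rho> i = Re ((\<rho> *\<^sub>v (bell_basis ! i)) \<bullet>c (bell_basis ! i))"

definition Phi_map :: "complex mat \<Rightarrow> complex mat" where
  "Phi_map \<rho> = Pi_plus * \<rho> * Pi_plus + Pi_minus * \<rho> * Pi_minus"

definition post_state :: "complex mat \<Rightarrow> complex mat \<Rightarrow> complex mat" where
  "post_state P \<rho> = (1 / mat_trace (P * \<rho>)) \<cdot>\<^sub>m (P * \<rho> * P)"

definition bit_flip_B :: "complex mat" where
  "bit_flip_B = tensor_mat (1\<^sub>m 2) (mat_of_rows_list 2 [[0, 1], [1, 0]])"

definition min_over :: "('a \<Rightarrow> real) \<Rightarrow> 'a set \<Rightarrow> real" where
  "min_over f A = (LEAST v. v \<in> f ` A)"

text \<open>If \<open>e\<^sub>b\<close> is 0 or 1, one of the conditional states has weight zero and is undefined; its term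
  vanishes because of the factor 0.\<close>

definition key_randomness :: "real \<Rightarrow> complex mat \<Rightarrow> real" where
  "key_randomness e\<^sub>b \<rho> = (1 - e\<^sub>b) * randomness (post_state Pi_plus \<rho>)
     + e\<^sub>b * randomness (bit_flip_B * post_state Pi_minus \<rho> * bit_flip_B)"

text \<open>Asymptotic key rate against collective attacks, with the reconciliation cost \<open>H(e\<^sub>b)\<close> of evenly
  distributed raw key bits.\<close>

definition symmetric_key_rate :: "complex mat set \<Rightarrow> real \<Rightarrow> real" where
  "symmetric_key_rate S e\<^sub>b = min_over (key_randomness e\<^sub>b) S - binary_entropy e\<^sub>b"

definition six_state_set :: "real \<Rightarrow> real \<Rightarrow> real \<Rightarrow> complex mat set" where
  "six_state_set e\<^sub>x e\<^sub>y e\<^sub>z = {\<rho>. density_operator 4 \<rho>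
     \<and> mat_trace (Pi_x_minus * \<rho>) = complex_of_real e\<^sub>x
     \<and> mat_trace (Pi_y_minus * \<rho>) = complex_of_real e\<^sub>y
     \<and> mat_trace (Pi_minus * \<rho>) = complex_of_real e\<^sub>z}"

end

theory Submission
  imports Defs "Jordan_Normal_Form.Spectral_Radius"
begin

text \<open>If \<open>X\<close> is the coefficient matrix of a purification of \<open>\<rho>\<close>, then \<open>\<rho> = X X\<^sup>*\<close>, the reduced state of \<open>E\<close>
  is the transpose of \<open>X\<^sup>* X\<close>, and the measured state is \<open>Y Y\<^sup>*\<close> for a matrix \<open>Y\<close> such that \<open>Y\<^sup>* Y\<close>
  is the diagonal part of \<open>\<rho>\<close>. As \<open>X X\<^sup>*\<close> and \<open>X\<^sup>* X\<close> have the same entropy, the randomness of \<open>\<rho>\<close> is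
  its coherence \<open>C(\<rho>)\<close>, whatever the purification.

  The state \<open>\<Phi>(\<rho>)\<close> is the direct sum of two Hermitian \<open>2 \<times> 2\<close> blocks, one on \<open>|00\<rangle>, |11\<rangle>\<close> and one on
  \<open>|01\<rangle>, |10\<rangle>\<close>. Coherence is additive over the blocks and homogeneous of degree one, which turns the
  weighted randomness of the key rate into \<open>C(\<Phi>(\<rho>))\<close>. The error rates fix the trace and the real part of
  the off-diagonal entry of each block. Under these constraints the coherence of a block is least
  when its diagonal is constant and its off-diagonal entry real, that is, for the Bell-diagonal
  state with the given weights \<open>p\<^sub>i\<close>.\<close>

section \<open>Spectral decomposition and entropy\<close>

lemma dim_mat_adjoint [simp]: "dim_row (mat_adjoint A) = dim_col A" "dim_col (mat_adjoint A) = dim_row A"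
  by (auto simp: mat_adjoint_def)

lemma index_mat_adjoint [simp]:
  fixes A :: "complex mat"
  assumes "i < dim_col A" "j < dim_row A"
  shows "mat_adjoint A $$ (i, j) = cnj (A $$ (j, i))"
  using assms by (simp add: mat_adjoint_def mat_of_rows_index)

lemma mat_adjoint_carrier [simp]: "mat_adjoint A \<in> carrier_mat n m \<longleftrightarrow> A \<in> carrier_mat m n"
  unfolding carrier_mat_def by auto

lemma mat_adjoint_adjoint [simp]: "mat_adjoint (mat_adjoint A) = (A :: complex mat)"
  by (rule eq_matI) simp_all

lemma index_mult_sum:
  assumes "A \<in> carrier_mat n m" "B \<in> carrier_mat m k" "i < n" "j < k"
  shows "(A * B) $$ (i, j) = (\<Sum>l<m. A $$ (i, l) * B $$ (l, j))"
  using assms by (simp add: scalar_prod_def atLeast0LessThan)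

lemma mat_adjoint_mult:
  fixes A B :: "complex mat"
  assumes A: "A \<in> carrier_mat n m" and B: "B \<in> carrier_mat m k"
  shows "mat_adjoint (A * B) = mat_adjoint B * mat_adjoint A"
proof (rule eq_matI)
  fix i j assume "i < dim_row (mat_adjoint B * mat_adjoint A)" "j < dim_col (mat_adjoint B * mat_adjoint A)"
  then have ij: "i < k" "j < n" using A B by auto
  have "mat_adjoint (A * B) $$ (i, j) = cnj ((A * B) $$ (j, i))"
    using A B ij by simp
  also have "\<dots> = (\<Sum>l<m. cnj (B $$ (l, i)) * cnj (A $$ (j, l)))"
    unfolding index_mult_sum[OF A B ij(2,1)] cnj_sum complex_cnj_mult by (simp only: mult.commute)
  also have "\<dots> = (mat_adjoint B * mat_adjoint A) $$ (i, j)"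
    using A B ij by (subst index_mult_sum[of _ k m _ n]) auto
  finally show "mat_adjoint (A * B) $$ (i, j) = (mat_adjoint B * mat_adjoint A) $$ (i, j)" .
qed (use A B in auto)

text \<open>The premises speak of dimensions only, so the simplifier can use this as a conditional
  rewrite rule and bring long products to right-nested form.\<close>

lemma mult_mat_assoc:
  fixes A :: "'a :: semiring_0 mat"
  assumes "dim_col A = dim_row B" "dim_col B = dim_row C"
  shows "A * B * C = A * (B * C)"
  using assms by (intro assoc_mult_mat) auto

section \<open>Spectral decompositions and the functional calculus\<close>

lemma spectral_decompositionD:
  assumes "spectral_decomposition A U d" "A \<in> carrier_mat n n"
  shows "U \<in> carrier_mat n n" "U * mat_adjoint U = 1\<^sub>m n" "mat_adjoint U * U = 1\<^sub>m n"
    "A = U * mat_diag n (\<lambda>i. complex_of_real (d i)) * mat_adjoint U"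
  using assms by (auto simp: spectral_decomposition_def Let_def)

lemma dim_mat_diag [simp]: "dim_row (mat_diag n f) = n" "dim_col (mat_diag n f) = n"
  by (auto simp: mat_diag_def)

lemma unitary_cancel:
  assumes "U \<in> carrier_mat n n" "mat_adjoint U * U = 1\<^sub>m n" "dim_row X = n"
  shows "mat_adjoint U * (U * X) = X"
proof -
  have "mat_adjoint U * (U * X) = (mat_adjoint U * U) * X"
    using assms(1,3) by (subst mult_mat_assoc) auto
  then show ?thesis unfolding assms(2) using left_mult_one_mat[of X n "dim_col X"] assms(3) by simp
qed

lemma spectral_decomposition_mult:
  assumes sd: "spectral_decomposition A U d" and A: "A \<in> carrier_mat n n"
  defines "D \<equiv> mat_diag n (\<lambda>i. complex_of_real (d i))"
  shows "mat_adjoint U * A = D * mat_adjoint U" "A * U = U * D"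
proof -
  note U = spectral_decompositionD[OF sd A]
  have A_eq: "A = U * (D * mat_adjoint U)"
    using U(1,4) by (simp add: D_def mult_mat_assoc)
  show "mat_adjoint U * A = D * mat_adjoint U"
    unfolding A_eq using U(1) by (intro unitary_cancel[OF U(1,3)]) (auto simp: D_def)
  have "A * U = U * (D * (mat_adjoint U * U))"
    unfolding A_eq using U(1) by (simp add: mult_mat_assoc D_def)
  then show "A * U = U * D" unfolding U(3) by (simp add: D_def)
qed

lemma spectral_decomposition_diagonalizes:
  assumes sd: "spectral_decomposition A U d" and A: "A \<in> carrier_mat n n"
  shows "mat_adjoint U * A * U = mat_diag n (\<lambda>i. complex_of_real (d i))"
proof -
  note U = spectral_decompositionD[OF sd A]
  show ?thesis
    using A U(1)
    by (simp add: mult_mat_assoc spectral_decomposition_mult(2)[OF sd A] unitary_cancel[OF U(1,3)])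
qed

text \<open>In the two eigenbases \<open>A * X = X * B\<close> becomes
  \<open>?D * ?W = ?W * ?E\<close> with diagonal factors, and entry (i, j) of this equation reads
  \<open>d i * W = W * e j\<close>. It is applied with \<open>X\<close> the identity to compare two
  decompositions of one matrix, and with a rectangular \<open>X\<close> to compare two
  spectra.\<close>

lemma spectral_intertwine:
  assumes A: "A \<in> carrier_mat n n" "spectral_decomposition A U d"
    and B: "B \<in> carrier_mat m m" "spectral_decomposition B V e"
    and X: "X \<in> carrier_mat n m" "A * X = X * B"
    and ij: "i < n" "j < m"
  shows "(mat_adjoint U * X * V) $$ (i, j) = 0 \<or> d i = e j"
proof -
  note U = spectral_decompositionD[OF A(2,1)] and V = spectral_decompositionD[OF B(2,1)]
  let ?D = "mat_diag n (\<lambda>i. complex_of_real (d i))"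
  let ?E = "mat_diag m (\<lambda>i. complex_of_real (e i))"
  let ?W = "mat_adjoint U * X * V"
  have W: "?W \<in> carrier_mat n m" using U(1) V(1) by auto
  note dims = carrier_matD[OF U(1)] carrier_matD[OF V(1)] carrier_matD[OF X(1)]
    carrier_matD[OF A(1)] carrier_matD[OF B(1)]
  have "?D * ?W = ?D * mat_adjoint U * (X * V)"
    by (simp add: mult_mat_assoc dims)
  also have "\<dots> = mat_adjoint U * (A * X) * V"
    unfolding spectral_decomposition_mult(1)[OF A(2,1), symmetric]
    by (simp add: mult_mat_assoc dims)
  also have "\<dots> = mat_adjoint U * X * (B * V)"
    unfolding X(2) by (simp add: mult_mat_assoc dims)
  also have "\<dots> = ?W * ?E"
    unfolding spectral_decomposition_mult(2)[OF B(2,1)] by (simp add: mult_mat_assoc dims)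
  finally have eq: "?D * ?W = ?W * ?E" .
  have "complex_of_real (d i) * ?W $$ (i, j) = ?W $$ (i, j) * complex_of_real (e j)"
    using arg_cong[OF eq, of "\<lambda>M. M $$ (i, j)"] ij
    unfolding mat_diag_mult_left[OF W] mat_diag_mult_right[OF W] by (simp only: index_mat split)
  then show ?thesis
    by (simp add: mult.commute[of _ "complex_of_real (e j)"])
qed

text \<open>The definite description is justified by comparing two decompositions through
  \<open>?W\<close>: this matrix couples only equal eigenvalues, so it intertwines the diagonal
  matrices of \<open>f (d i)\<close> and \<open>f (e i)\<close> for every \<open>f\<close>, whatever
  the order or multiplicity of the eigenvalues.\<close>

lemma hermitian_fun_eq:
  assumes sd: "spectral_decomposition A U d" and A: "A \<in> carrier_mat n n"
  shows "hermitian_fun f A = U * mat_diag n (\<lambda>i. complex_of_real (f (d i))) * mat_adjoint U"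
  unfolding hermitian_fun_def
proof (rule the_equality)
  show "\<exists>U' d'. spectral_decomposition A U' d' \<and> U * mat_diag n (\<lambda>i. complex_of_real (f (d i))) * mat_adjoint U
      = U' * mat_diag (dim_row A) (\<lambda>i. complex_of_real (f (d' i))) * mat_adjoint U'"
    using sd A by auto
next
  fix B assume "\<exists>V e. spectral_decomposition A V e
     \<and> B = V * mat_diag (dim_row A) (\<lambda>i. complex_of_real (f (e i))) * mat_adjoint V"
  then obtain V e where sdV: "spectral_decomposition A V e"
    and B: "B = V * mat_diag n (\<lambda>i. complex_of_real (f (e i))) * mat_adjoint V"
    using A by auto
  note U = spectral_decompositionD[OF sd A] and V = spectral_decompositionD[OF sdV A]
  let ?D = "mat_diag n (\<lambda>i. complex_of_real (f (d i)))"
  let ?E = "mat_diag n (\<lambda>i. complex_of_real (f (e i)))"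
  let ?W = "mat_adjoint U * V"
  note dims = carrier_matD[OF U(1)] carrier_matD[OF V(1)]
  have W: "?W \<in> carrier_mat n n" using dims by auto
  have W0: "?W $$ (i, j) = 0 \<or> d i = e j" if "i < n" "j < n" for i j
    using spectral_intertwine[OF A sd A sdV, of "1\<^sub>m n" i j] that A U(1) by simp
  have eq: "?D * ?W = ?W * ?E"
    unfolding mat_diag_mult_left[OF W] mat_diag_mult_right[OF W]
  proof (rule cong_mat)
    fix i j assume "i < n" "j < n"
    with W0[of i j] show "(case (i, j) of (i, j) \<Rightarrow> complex_of_real (f (d i)) * ?W $$ (i, j))
        = (case (i, j) of (i, j) \<Rightarrow> ?W $$ (i, j) * complex_of_real (f (e j)))" by auto
  qed auto
  have "B = (U * mat_adjoint U) * V * ?E * mat_adjoint V"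
    using B V(1) by (simp add: U(2))
  also have "\<dots> = U * (?W * ?E) * mat_adjoint V"
    by (simp add: mult_mat_assoc dims)
  also have "\<dots> = U * ?D * mat_adjoint U * (V * mat_adjoint V)"
    unfolding eq[symmetric] by (simp add: mult_mat_assoc dims)
  also have "\<dots> = U * ?D * mat_adjoint U"
    unfolding V(2) by (rule right_mult_one_mat) (auto simp: dims)
  finally show "B = U * ?D * mat_adjoint U" .
qed

lemma trace_unitary_conj_diag:
  assumes U: "U \<in> carrier_mat n n" "mat_adjoint U * U = 1\<^sub>m n"
  shows "mat_trace (U * mat_diag n g * mat_adjoint U) = (\<Sum>i<n. g i)"
proof -
  have "mat_trace (U * mat_diag n g * mat_adjoint U) = (\<Sum>i<n. \<Sum>k<n. U $$ (i, k) * g k * cnj (U $$ (i, k)))"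
    unfolding mat_trace_def mat_diag_mult_right[OF U(1)]
    using U(1) by (intro sum.cong) (auto simp: scalar_prod_def atLeast0LessThan)
  also have "\<dots> = (\<Sum>k<n. g k * (\<Sum>i<n. cnj (U $$ (i, k)) * U $$ (i, k)))"
    by (subst sum.swap) (simp add: sum_distrib_left mult_ac)
  also have "\<dots> = (\<Sum>k<n. g k * (mat_adjoint U * U) $$ (k, k))"
    using U(1) by (intro sum.cong) (auto simp: scalar_prod_def atLeast0LessThan)
  also have "\<dots> = (\<Sum>k<n. g k)" unfolding U(2) by simp
  finally show ?thesis .
qed

text \<open>The matrix and its logarithm are diagonal in the same basis, so the trace of their
  product is a sum over eigenvalues. All entropies below are computed through this formula, with any
  convenient decomposition.\<close>

lemma vn_entropy_eq:
  assumes sd: "spectral_decomposition A U d" and A: "A \<in> carrier_mat n n"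
  shows "vn_entropy A = - (\<Sum>i<n. d i * log 2 (d i))"
proof -
  note U = spectral_decompositionD[OF sd A]
  let ?D = "mat_diag n (\<lambda>i. complex_of_real (d i))"
  let ?E = "mat_diag n (\<lambda>i. complex_of_real (log 2 (d i)))"
  note dims = carrier_matD[OF U(1)]
  have "A * hermitian_fun (log 2) A = (A * U) * ?E * mat_adjoint U"
    unfolding hermitian_fun_eq[OF sd A] using A by (simp add: mult_mat_assoc dims)
  also have "\<dots> = U * (?D * ?E) * mat_adjoint U"
    unfolding spectral_decomposition_mult(2)[OF sd A]
    by (simp add: mult_mat_assoc dims del: mat_diag_diag)
  also have "?D * ?E = mat_diag n (\<lambda>i. complex_of_real (d i * log 2 (d i)))" by simp
  finally show ?thesis
    unfolding vn_entropy_def by (simp add: trace_unitary_conj_diag[OF U(1,3)])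
qed

section \<open>Existence of spectral decompositions for Hermitian matrices\<close>

lemma unitary_with_first_column:
  fixes v :: "complex vec"
  assumes v: "v \<in> carrier_vec n" "v \<noteq> 0\<^sub>v n"
  obtains W c where "W \<in> carrier_mat n n" "mat_adjoint W * W = 1\<^sub>m n" "W * mat_adjoint W = 1\<^sub>m n"
    "\<And>i. i < n \<Longrightarrow> W $$ (i, 0) = c * v $ i"
proof -
  have n: "n \<noteq> 0" using v by (metis carrier_vecD eq_vecI index_zero_vec(2) less_nat_zero_code)
  interpret cof_vec_space n "TYPE(complex)" .
  \<comment> \<open>Gram-Schmidt applied to a basis that starts with \<open>v\<close> leaves
    \<open>v\<close> in first place.\<close>
  define b where "b = basis_completion v"
  define ws where "ws = gram_schmidt n b"
  from basis_completion[OF v, folded b_def]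
  have dist_b: "distinct b" and indep: "\<not> lin_dep (set b)" and b: "set b \<subseteq> carrier_vec n"
    and hdb: "hd b = v" and len_b: "length b = n" by auto
  from hdb len_b n obtain vs where bv: "b = v # vs" by (cases b) auto
  from gram_schmidt_result[OF b dist_b indep refl, folded ws_def]
  have ws: "set ws \<subseteq> carrier_vec n" "corthogonal ws" "length ws = n"
    by (auto simp: len_b)
  from gram_schmidt_hd[OF v(1), of vs, folded bv] have hdws: "ws ! 0 = v"
    unfolding ws_def using n ws(3) by (metis hd_conv_nth list.size(3) ws_def)
  have wsc: "ws ! j \<in> carrier_vec n" if "j < n" for j using that ws by auto
  define s where "s j = (\<Sum>k<n. (cmod (ws ! j $ k))\<^sup>2)" for j
  have ip: "ws ! j \<bullet>c ws ! i = (\<Sum>k<n. cnj (ws ! i $ k) * ws ! j $ k)" if "i < n" "j < n" for i j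
    using wsc[OF that(1)] wsc[OF that(2)] by (simp add: scalar_prod_def atLeast0LessThan mult.commute)
  have ip_self: "ws ! j \<bullet>c ws ! j = complex_of_real (s j)" if "j < n" for j
    unfolding ip[OF that that] s_def of_real_sum
    by (intro sum.cong refl) (simp only: complex_norm_square mult.commute)
  have s_pos: "s j > 0" if "j < n" for j
  proof -
    have "s j \<noteq> 0" using corthogonalD[OF ws(2), of j j] that ws(3) ip_self[OF that] by auto
    moreover have "s j \<ge> 0" unfolding s_def by (intro sum_nonneg) auto
    ultimately show ?thesis by simp
  qed
  \<comment> \<open>The Gram-Schmidt vectors are orthogonal but not normalized; dividing column
    \<open>j\<close> by its norm makes the matrix unitary. The constant \<open>c\<close> is
    therefore the inverse norm of \<open>v\<close>.\<close>
  define W where "W = mat n n (\<lambda>(i, j). ws ! j $ i / complex_of_real (sqrt (s j)))"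
  have W: "W \<in> carrier_mat n n" unfolding W_def by simp
  have WW: "mat_adjoint W * W = 1\<^sub>m n"
  proof (rule eq_matI)
    fix i j assume "i < dim_row (1\<^sub>m n :: complex mat)" "j < dim_col (1\<^sub>m n :: complex mat)"
    then have ij: "i < n" "j < n" by auto
    have "(mat_adjoint W * W) $$ (i, j) = (\<Sum>k<n. cnj (W $$ (k, i)) * W $$ (k, j))"
      using W ij by (subst index_mult_sum[of _ n n _ n]) auto
    also have "\<dots> = (\<Sum>k<n. cnj (ws ! i $ k) * ws ! j $ k) / complex_of_real (sqrt (s i) * sqrt (s j))"
      using ij by (simp add: W_def sum_divide_distrib)
    also have "\<dots> = (ws ! j \<bullet>c ws ! i) / complex_of_real (sqrt (s i) * sqrt (s j))"
      using ip[OF ij] by simp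
    also have "\<dots> = (if i = j then 1 else 0)"
    proof (cases "i = j")
      case True
      then show ?thesis using ip_self[OF ij(1)] s_pos[OF ij(1)] by simp
    next
      case False
      then show ?thesis using corthogonalD[OF ws(2), of j i] ij ws(3) by simp
    qed
    finally show "(mat_adjoint W * W) $$ (i, j) = 1\<^sub>m n $$ (i, j)" using ij by simp
  qed (use W in auto)
  have "W * mat_adjoint W = 1\<^sub>m n"
    using mat_mult_left_right_inverse[OF _ W WW] W by simp
  moreover have "W $$ (i, 0) = 1 / complex_of_real (sqrt (s 0)) * v $ i" if "i < n" for i
    using that n hdws by (simp add: W_def)
  ultimately show thesis using that W WW by blast
qed

lemma spectral_decompositionI:
  assumes "A \<in> carrier_mat n n" "U \<in> carrier_mat n n" "U * mat_adjoint U = 1\<^sub>m n"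
    "mat_adjoint U * U = 1\<^sub>m n" "A = U * mat_diag n (\<lambda>i. complex_of_real (d i)) * mat_adjoint U"
  shows "spectral_decomposition A U d"
  using assms unfolding spectral_decomposition_def Let_def by auto

text \<open>Deflation by induction on the dimension: a unitary change of basis makes an eigenvector
  the first basis vector, Hermiticity then splits off a 1-by-1 block, and the induction hypothesis
  diagonalizes the remaining Hermitian block.\<close>

lemma hermitian_spectral_decomposition:
  assumes "A \<in> carrier_mat n n" "mat_adjoint A = A"
  shows "\<exists>U d. spectral_decomposition A U d"
  using assms
proof (induction n arbitrary: A)
  case 0
  have "spectral_decomposition A (1\<^sub>m 0) (\<lambda>_. 0)"
    using 0 by (intro spectral_decompositionI[of _ 0]) (auto intro!: eq_matI)
  then show ?case by blast
next
  case (Suc n)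
  let ?N = "Suc n"
  note A = Suc.prems(1)
  obtain e v where "eigenvector A v e"
    using spectrum_non_empty[OF A] unfolding spectrum_def eigenvalue_def by auto
  then have v: "v \<in> carrier_vec ?N" "v \<noteq> 0\<^sub>v ?N" and ev: "A *\<^sub>v v = e \<cdot>\<^sub>v v"
    using A unfolding eigenvector_def by auto
  obtain W c where W: "W \<in> carrier_mat ?N ?N" "mat_adjoint W * W = 1\<^sub>m ?N" "W * mat_adjoint W = 1\<^sub>m ?N"
    and W0: "\<And>i. i < ?N \<Longrightarrow> W $$ (i, 0) = c * v $ i"
    using unitary_with_first_column[OF v] by blast
  note dims = carrier_matD[OF A] carrier_matD[OF W(1)]
  have AW0: "(A * W) $$ (i, 0) = e * W $$ (i, 0)" if i: "i < ?N" for i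
  proof -
    have "(A * W) $$ (i, 0) = c * (A *\<^sub>v v) $ i"
      unfolding index_mult_sum[OF A W(1) i zero_less_Suc]
      using i A v(1) by (simp add: W0 scalar_prod_def sum_distrib_left mult_ac atLeast0LessThan del: sum.lessThan_Suc)
    then show ?thesis using i v(1) by (simp add: ev W0)
  qed
  define B where "B = mat_adjoint W * (A * W)"
  have B: "B \<in> carrier_mat ?N ?N" unfolding B_def using A W(1) by auto
  have B_herm: "mat_adjoint B = B"
    unfolding B_def using A W(1) Suc.prems(2)
    by (simp add: mat_adjoint_mult[of _ ?N ?N _ ?N] mult_mat_assoc)
  have B0: "B $$ (i, 0) = (if i = 0 then e else 0)" if i: "i < ?N" for i
  proof -
    have "B $$ (i, 0) = (\<Sum>k<?N. mat_adjoint W $$ (i, k) * (A * W) $$ (k, 0))"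
      unfolding B_def using A W(1) i by (intro index_mult_sum[of _ ?N ?N _ ?N]) auto
    also have "\<dots> = e * (\<Sum>k<?N. mat_adjoint W $$ (i, k) * W $$ (k, 0))"
      unfolding sum_distrib_left by (intro sum.cong refl) (simp add: AW0)
    also have "(\<Sum>k<?N. mat_adjoint W $$ (i, k) * W $$ (k, 0)) = (mat_adjoint W * W) $$ (i, 0)"
      using W(1) i by (intro index_mult_sum[of _ ?N ?N _ ?N, symmetric]) auto
    finally show ?thesis unfolding W(2) using i by auto
  qed
  have B_cnj: "B $$ (i, j) = cnj (B $$ (j, i))" if "i < ?N" "j < ?N" for i j
    using arg_cong[OF B_herm, of "\<lambda>M. M $$ (i, j)"] that B by simp
  \<comment> \<open>The eigenvalue is a diagonal entry of a Hermitian matrix, hence real.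
    Hermiticity then also carries the zeros of the first column over to the first row.\<close>
  have "e = cnj e" using B_cnj[of 0 0] B0[of 0] by simp
  then obtain \<epsilon> where e_real: "e = complex_of_real \<epsilon>"
    by (metis Reals_cases Reals_cnj_iff)
  have B0': "B $$ (0, j) = (if j = 0 then e else 0)" if j: "j < ?N" for j
    unfolding B_cnj[OF zero_less_Suc j] B0[OF j] using e_real by simp
  define A' where "A' = mat n n (\<lambda>(i, j). B $$ (Suc i, Suc j))"
  have A': "A' \<in> carrier_mat n n" unfolding A'_def by simp
  moreover have "mat_adjoint A' = A'"
    unfolding A'_def by (rule eq_matI) (auto intro: B_cnj[symmetric])
  ultimately obtain U' d' where sd': "spectral_decomposition A' U' d'"
    using Suc.IH by blast
  note U' = spectral_decompositionD[OF sd' A']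
  let ?Z = "\<lambda>M. four_block_mat (1\<^sub>m 1) (0\<^sub>m 1 n) (0\<^sub>m n 1) M"
  define d where "d i = (case i of 0 \<Rightarrow> \<epsilon> | Suc k \<Rightarrow> d' k)" for i
  have D: "mat_diag ?N (\<lambda>i. complex_of_real (d i))
      = four_block_mat (mat 1 1 (\<lambda>_. e)) (0\<^sub>m 1 n) (0\<^sub>m n 1) (mat_diag n (\<lambda>i. complex_of_real (d' i)))"
    (is "?L = ?R")
  proof (rule eq_matI)
    fix i j assume "i < dim_row ?R" "j < dim_col ?R"
    then show "?L $$ (i, j) = ?R $$ (i, j)"
      using e_real by (cases i; cases j) (simp_all add: mat_diag_def d_def)
  qed simp_all
  have B_block: "B = four_block_mat (mat 1 1 (\<lambda>_. e)) (0\<^sub>m 1 n) (0\<^sub>m n 1) A'"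
  proof (rule eq_matI)
    fix i j assume "i < dim_row (four_block_mat (mat 1 1 (\<lambda>_. e)) (0\<^sub>m 1 n) (0\<^sub>m n 1) A')"
      "j < dim_col (four_block_mat (mat 1 1 (\<lambda>_. e)) (0\<^sub>m 1 n) (0\<^sub>m n 1) A')"
    then have ij: "i < ?N" "j < ?N" using A' by auto
    show "B $$ (i, j) = four_block_mat (mat 1 1 (\<lambda>_. e)) (0\<^sub>m 1 n) (0\<^sub>m n 1) A' $$ (i, j)"
      using ij B0[of i] B0'[of j] A' by (cases i; cases j) (auto simp: A'_def)
  qed (use A' B in auto)
  have Z_adj: "mat_adjoint (?Z U') = ?Z (mat_adjoint U')"
    using U'(1) by (intro eq_matI) auto
  have Z_mult: "?Z M * ?Z M' = ?Z (M * M')" if "M \<in> carrier_mat n n" "M' \<in> carrier_mat n n" for M M' :: "complex mat"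
    using that by (subst mult_four_block_mat[of _ 1 1 _ n _ n _ _ 1 _ n]) auto
  have Z: "?Z U' \<in> carrier_mat ?N ?N" using U'(1) by auto
  have ZZ: "mat_adjoint (?Z U') * ?Z U' = 1\<^sub>m ?N" "?Z U' * mat_adjoint (?Z U') = 1\<^sub>m ?N"
    unfolding Z_adj using Z_mult[of U' "mat_adjoint U'"] Z_mult[of "mat_adjoint U'" U'] U'(1)
    by (simp_all add: U'(2,3) four_block_one_mat[of 1 n, simplified])
  have B_eq: "B = ?Z U' * mat_diag ?N (\<lambda>i. complex_of_real (d i)) * mat_adjoint (?Z U')"
    unfolding D Z_adj B_block
    using U'(1)
    by (subst mult_four_block_mat[of _ 1 1 _ n _ n _ _ 1 _ n], simp_all,
        subst mult_four_block_mat[of _ 1 1 _ n _ n _ _ 1 _ n], simp_all add: U'(4)[symmetric] left_add_zero_mat[OF A'])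
  define Y where "Y = ?Z U'"
  note Y = Z[folded Y_def] and YY = ZZ[folded Y_def] and B_eq = B_eq[folded Y_def]
  have "spectral_decomposition A (W * Y) d"
  proof (rule spectral_decompositionI[OF A])
    note adj = mat_adjoint_mult[OF W(1) Y]
    note dimZ = carrier_matD[OF Y]
    show "W * Y \<in> carrier_mat ?N ?N" using W(1) Y by auto
    have "W * Y * mat_adjoint (W * Y) = W * (Y * mat_adjoint (Y)) * mat_adjoint W"
      unfolding adj by (simp add: mult_mat_assoc dims dimZ)
    then show "W * Y * mat_adjoint (W * Y) = 1\<^sub>m ?N"
      unfolding YY using W(1,3) by simp
    have "mat_adjoint (W * Y) * (W * Y) = mat_adjoint (Y) * ((mat_adjoint W * W) * Y)"
      unfolding adj by (simp add: mult_mat_assoc dims dimZ)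
    then show "mat_adjoint (W * Y) * (W * Y) = 1\<^sub>m ?N"
      unfolding W(2) left_mult_one_mat[OF Y] YY .
    have "A = (W * mat_adjoint W) * A * (W * mat_adjoint W)"
      unfolding W(3) using A by simp
    also have "\<dots> = W * B * mat_adjoint W"
      unfolding B_def by (simp add: mult_mat_assoc dims)
    also have "\<dots> = W * Y * mat_diag ?N (\<lambda>i. complex_of_real (d i)) * mat_adjoint (W * Y)"
      unfolding B_eq adj by (simp add: mult_mat_assoc dims dimZ)
    finally show "A = W * Y * mat_diag ?N (\<lambda>i. complex_of_real (d i)) * mat_adjoint (W * Y)" .
  qed
  then show ?case by blast
qed

section \<open>Randomness and coherence\<close>

text \<open>In eigenbases of \<open>X X\<^sup>*\<close> and \<open>X\<^sup>* X\<close>, the matrix of \<open>X\<close> couples only equal eigenvalues, and the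
  squared moduli of its entries sum to the eigenvalues along rows and along columns.\<close>

lemma vn_entropy_mult_adjoint_commute:
  assumes X: "X \<in> carrier_mat n m"
  shows "vn_entropy (X * mat_adjoint X) = vn_entropy (mat_adjoint X * X)"
proof -
  let ?A = "X * mat_adjoint X" and ?B = "mat_adjoint X * X"
  note dX = carrier_matD[OF X]
  have A: "?A \<in> carrier_mat n n" and B: "?B \<in> carrier_mat m m" using X by auto
  have herm: "mat_adjoint ?A = ?A" "mat_adjoint ?B = ?B"
    using mat_adjoint_mult[of X n m "mat_adjoint X" n] mat_adjoint_mult[of "mat_adjoint X" m n X m] X by auto
  obtain U d where sdA: "spectral_decomposition ?A U d"
    using hermitian_spectral_decomposition[OF A herm(1)] by blast
  obtain V e where sdB: "spectral_decomposition ?B V e"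
    using hermitian_spectral_decomposition[OF B herm(2)] by blast
  note U = spectral_decompositionD[OF sdA A] and V = spectral_decompositionD[OF sdB B]
  note dims = carrier_matD[OF U(1)] carrier_matD[OF V(1)] dX
  define W where "W = mat_adjoint U * X * V"
  have W: "W \<in> carrier_mat n m" unfolding W_def using U(1) V(1) X by auto
  have W0: "W $$ (i, j) = 0 \<or> d i = e j" if "i < n" "j < m" for i j
    unfolding W_def using spectral_intertwine[OF A sdA B sdB X] that by (simp add: mult_mat_assoc dX)
  have W_adj: "mat_adjoint W = mat_adjoint V * mat_adjoint X * U"
  proof -
    have UX: "mat_adjoint U * X \<in> carrier_mat n m" using U(1) X by auto
    show ?thesis
      unfolding W_def mat_adjoint_mult[OF UX V(1)]
      using mat_adjoint_mult[of "mat_adjoint U" n n X m] U(1) X by (simp add: mult_mat_assoc dims)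
  qed
  have "W * mat_adjoint W = mat_adjoint U * X * (V * mat_adjoint V) * mat_adjoint X * U"
    unfolding W_adj unfolding W_def by (simp add: mult_mat_assoc dims)
  also have "\<dots> = mat_adjoint U * X * 1\<^sub>m m * mat_adjoint X * U" unfolding V(2) ..
  also have "\<dots> = mat_adjoint U * ?A * U"
    using right_mult_one_mat[of "mat_adjoint U * X" n m] U(1) X by (simp add: mult_mat_assoc dims)
  finally have WW: "W * mat_adjoint W = mat_diag n (\<lambda>i. complex_of_real (d i))"
    unfolding spectral_decomposition_diagonalizes[OF sdA A] .
  have "mat_adjoint W * W = mat_adjoint V * mat_adjoint X * (U * mat_adjoint U) * X * V"
    unfolding W_adj unfolding W_def by (simp add: mult_mat_assoc dims)
  also have "\<dots> = mat_adjoint V * mat_adjoint X * 1\<^sub>m n * X * V" unfolding U(2) ..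
  also have "\<dots> = mat_adjoint V * ?B * V"
    using right_mult_one_mat[of "mat_adjoint V * mat_adjoint X" m n] V(1) X by (simp add: mult_mat_assoc dims)
  finally have WW': "mat_adjoint W * W = mat_diag m (\<lambda>i. complex_of_real (e i))"
    unfolding spectral_decomposition_diagonalizes[OF sdB B] .
  have d: "d i = (\<Sum>j<m. (cmod (W $$ (i, j)))\<^sup>2)" if i: "i < n" for i
  proof -
    have "complex_of_real (d i) = (W * mat_adjoint W) $$ (i, i)"
      unfolding WW using i by (simp add: mat_diag_def)
    also have "\<dots> = (\<Sum>j<m. W $$ (i, j) * mat_adjoint W $$ (j, i))"
      using W i by (intro index_mult_sum[of _ n m _ n]) auto
    also have "\<dots> = (\<Sum>j<m. W $$ (i, j) * cnj (W $$ (i, j)))"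
      using W i by (intro sum.cong) auto
    also have "\<dots> = complex_of_real (\<Sum>j<m. (cmod (W $$ (i, j)))\<^sup>2)"
      unfolding of_real_sum complex_norm_square ..
    finally show ?thesis unfolding of_real_eq_iff .
  qed
  have e: "e j = (\<Sum>i<n. (cmod (W $$ (i, j)))\<^sup>2)" if j: "j < m" for j
  proof -
    have "complex_of_real (e j) = (mat_adjoint W * W) $$ (j, j)"
      unfolding WW' using j by (simp add: mat_diag_def)
    also have "\<dots> = (\<Sum>i<n. mat_adjoint W $$ (j, i) * W $$ (i, j))"
      using W j by (intro index_mult_sum[of _ m n _ m]) auto
    also have "\<dots> = (\<Sum>i<n. W $$ (i, j) * cnj (W $$ (i, j)))"
      using W j by (intro sum.cong) auto
    also have "\<dots> = complex_of_real (\<Sum>i<n. (cmod (W $$ (i, j)))\<^sup>2)"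
      unfolding of_real_sum complex_norm_square ..
    finally show ?thesis unfolding of_real_eq_iff .
  qed
  have "(\<Sum>i<n. d i * log 2 (d i)) = (\<Sum>i<n. \<Sum>j<m. (cmod (W $$ (i, j)))\<^sup>2 * log 2 (d i))"
    by (intro sum.cong refl) (subst (1) d, simp_all add: sum_distrib_right)
  \<comment> \<open>Where the weight is nonzero the two eigenvalues agree, so one logarithm may
    replace the other. The dimensions \<open>n\<close> and \<open>m\<close> may differ: the surplus
    eigenvalues have only zero weights.\<close>
  also have "\<dots> = (\<Sum>i<n. \<Sum>j<m. (cmod (W $$ (i, j)))\<^sup>2 * log 2 (e j))"
  proof (intro sum.cong refl)
    fix i j assume "i \<in> {..<n}" "j \<in> {..<m}"
    with W0[of i j] show "(cmod (W $$ (i, j)))\<^sup>2 * log 2 (d i) = (cmod (W $$ (i, j)))\<^sup>2 * log 2 (e j)"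
      by auto
  qed
  also have "\<dots> = (\<Sum>j<m. \<Sum>i<n. (cmod (W $$ (i, j)))\<^sup>2 * log 2 (e j))" by (rule sum.swap)
  also have "\<dots> = (\<Sum>j<m. e j * log 2 (e j))"
    by (intro sum.cong refl) (subst (2) e, simp_all add: sum_distrib_right)
  finally show ?thesis
    unfolding vn_entropy_eq[OF sdA A] vn_entropy_eq[OF sdB B] by simp
qed

section \<open>Purifications and the measured state\<close>

lemma transpose_mat_diag [simp]: "transpose_mat (mat_diag n f) = mat_diag n f"
  by (rule eq_matI) (auto simp: mat_diag_def)

text \<open>Transposing a spectral decomposition gives one with the entrywise conjugate of
  \<open>U\<close> and the same eigenvalues. This removes the transpose that appears in the reduced
  state of \<open>E\<close>.\<close>

lemma vn_entropy_transpose: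
  assumes A: "A \<in> carrier_mat n n" "mat_adjoint A = A"
  shows "vn_entropy (transpose_mat A) = vn_entropy A"
proof -
  obtain U d where sd: "spectral_decomposition A U d"
    using hermitian_spectral_decomposition[OF A] by blast
  note U = spectral_decompositionD[OF sd A(1)]
  note dims = carrier_matD[OF U(1)]
  let ?V = "transpose_mat (mat_adjoint U)"
  have V_adj: "mat_adjoint ?V = transpose_mat U"
    using dims by (intro eq_matI) auto
  have "spectral_decomposition (transpose_mat A) ?V d"
  proof (rule spectral_decompositionI)
    show "transpose_mat A \<in> carrier_mat n n" "?V \<in> carrier_mat n n" using A U(1) by auto
    show "?V * mat_adjoint ?V = 1\<^sub>m n"
      unfolding V_adj using transpose_mult[of U n n "mat_adjoint U" n] U(1,2) by simp
    show "mat_adjoint ?V * ?V = 1\<^sub>m n"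
      unfolding V_adj using transpose_mult[of "mat_adjoint U" n n U n] U(1,3) by simp
    let ?D = "mat_diag n (\<lambda>i. complex_of_real (d i))"
    have "transpose_mat A = ?V * transpose_mat (U * ?D)"
      using U(1) transpose_mult[of "U * ?D" n n "mat_adjoint U" n] by (subst U(4)) auto
    also have "transpose_mat (U * ?D) = ?D * transpose_mat U"
      using transpose_mult[of U n n ?D n] U(1) by auto
    finally show "transpose_mat A = ?V * ?D * mat_adjoint ?V"
      unfolding V_adj by (simp add: mult_mat_assoc dims)
  qed
  then show ?thesis
    using vn_entropy_eq[OF sd A(1)] vn_entropy_eq[of "transpose_mat A" ?V d n] A(1) by simp
qed

text \<open>Arranging the amplitudes with rows indexed by \<open>Q\<close> and columns by
  \<open>E\<close> turns both partial traces into matrix products; row \<open>i\<close> is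
  \<open>bra_Q m i \<psi>\<close>.\<close>

definition coeff_mat :: "nat \<Rightarrow> nat \<Rightarrow> complex vec \<Rightarrow> complex mat" where
  "coeff_mat n m \<psi> = mat n m (\<lambda>(i, k). \<psi> $ (i * m + k))"

lemma coeff_mat_carrier [simp]: "coeff_mat n m \<psi> \<in> carrier_mat n m"
  by (simp add: coeff_mat_def)

lemma product_index_less:
  fixes i k n m :: nat
  assumes "i < n" "k < m"
  shows "i * m + k < n * m"
proof -
  have "i * m + k < Suc i * m" using assms(2) by simp
  also have "\<dots> \<le> n * m" using assms(1) by (intro mult_le_mono1) simp
  finally show ?thesis .
qed

lemma trace_out_E_ketbra:
  assumes "\<psi> \<in> carrier_vec (n * m)"
  shows "trace_out_E n m (ketbra \<psi>) = coeff_mat n m \<psi> * mat_adjoint (coeff_mat n m \<psi>)"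
proof (rule eq_matI)
  let ?X = "coeff_mat n m \<psi>"
  fix i j assume "i < dim_row (?X * mat_adjoint ?X)" "j < dim_col (?X * mat_adjoint ?X)"
  then have ij: "i < n" "j < n" by (auto simp: coeff_mat_def)
  have "(?X * mat_adjoint ?X) $$ (i, j) = (\<Sum>k<m. ?X $$ (i, k) * mat_adjoint ?X $$ (k, j))"
    using ij by (intro index_mult_sum[of _ n m _ n]) auto
  also have "\<dots> = trace_out_E n m (ketbra \<psi>) $$ (i, j)"
    using ij assms by (auto simp: trace_out_E_def ketbra_def coeff_mat_def product_index_less intro!: sum.cong)
  finally show "trace_out_E n m (ketbra \<psi>) $$ (i, j) = (?X * mat_adjoint ?X) $$ (i, j)" ..
qed (auto simp: trace_out_E_def coeff_mat_def)

text \<open>A product index splits into its \<open>Q\<close> part by \<open>div m\<close> and its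
  \<open>E\<close> part by \<open>mod m\<close>. In the sum over outcomes only the outcome equal to
  the \<open>Q\<close> parts of both row and column contributes.\<close>

lemma index_measured_state:
  assumes "r < n * m" "c < n * m"
  shows "measured_state n m \<psi> $$ (r, c) = (if r div m = c div m
    then coeff_mat n m \<psi> $$ (r div m, r mod m) * cnj (coeff_mat n m \<psi> $$ (c div m, c mod m)) else 0)"
proof -
  have m: "m > 0" using assms by (cases m) auto
  have d: "r div m < n" "c div m < n" "r mod m < m" "c mod m < m"
    using assms m by (auto simp: less_mult_imp_div_less)
  have bra: "bra_Q m i \<psi> $ k = coeff_mat n m \<psi> $$ (i, k)" if "i < n" "k < m" for i k
    using that by (simp add: bra_Q_def coeff_mat_def)
  have dim_bra: "dim_vec (bra_Q m i \<psi>) = m" for i by (simp add: bra_Q_def)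
  have "measured_state n m \<psi> $$ (r, c) = (\<Sum>i<n. if i = r div m then
      (if r div m = c div m then coeff_mat n m \<psi> $$ (r div m, r mod m) * cnj (coeff_mat n m \<psi> $$ (c div m, c mod m)) else 0)
      else 0)"
    unfolding measured_state_def index_mat(1)[OF assms]
    using assms d by (intro sum.cong refl) (auto simp: tensor_mat_def ketbra_def unit_vec_def bra dim_bra)
  also have "\<dots> = (if r div m = c div m
    then coeff_mat n m \<psi> $$ (r div m, r mod m) * cnj (coeff_mat n m \<psi> $$ (c div m, c mod m)) else 0)"
    using d by simp
  finally show ?thesis .
qed

text \<open>The trace over \<open>Q\<close> sees only the diagonal blocks, which the measurement
  keeps. The conjugated factor carries the column index here, which is why a transpose
  appears.\<close>

lemma trace_out_Q_measured_state:
  "trace_out_Q n m (measured_state n m \<psi>)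
    = transpose_mat (mat_adjoint (coeff_mat n m \<psi>) * coeff_mat n m \<psi>)" (is "?L = transpose_mat (mat_adjoint ?X * ?X)")
proof (rule eq_matI)
  fix k l assume "k < dim_row (transpose_mat (mat_adjoint ?X * ?X))" "l < dim_col (transpose_mat (mat_adjoint ?X * ?X))"
  then have kl: "k < m" "l < m" by (auto simp: coeff_mat_def)
  have dims: "dim_row ?X = n" "dim_col ?X = m" by (auto simp: coeff_mat_def)
  have "transpose_mat (mat_adjoint ?X * ?X) $$ (k, l) = (mat_adjoint ?X * ?X) $$ (l, k)"
    using kl by (simp add: dims del: index_mult_mat(1))
  also have "\<dots> = (\<Sum>i<n. mat_adjoint ?X $$ (l, i) * ?X $$ (i, k))"
    using kl by (intro index_mult_sum[of _ m n _ m]) auto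
  also have "\<dots> = (\<Sum>i<n. measured_state n m \<psi> $$ (i * m + k, i * m + l))"
    using kl by (intro sum.cong) (auto simp: index_measured_state product_index_less dims)
  finally show "?L $$ (k, l) = transpose_mat (mat_adjoint ?X * ?X) $$ (k, l)"
    using kl by (simp add: trace_out_Q_def)
qed (auto simp: trace_out_Q_def coeff_mat_def)

text \<open>Column \<open>i\<close> of \<open>Y\<close> is the unnormalized post-measurement vector
  for outcome \<open>i\<close>, namely \<open>|i>\<close> tensored with row \<open>i\<close> of the
  coefficient matrix. These columns are mutually orthogonal, so their Gram matrix is diagonal, and
  its entries are the outcome probabilities.\<close>

lemma vn_entropy_measured_state:
  "vn_entropy (measured_state n m \<psi>) = vn_entropy (diag_part (coeff_mat n m \<psi> * mat_adjoint (coeff_mat n m \<psi>)))"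
proof -
  let ?X = "coeff_mat n m \<psi>"
  define Y where "Y = mat (n * m) n (\<lambda>(r, i). if r div m = i then ?X $$ (i, r mod m) else 0)"
  have Y: "Y \<in> carrier_mat (n * m) n" unfolding Y_def by simp
  have "measured_state n m \<psi> = Y * mat_adjoint Y"
  proof (rule eq_matI)
    fix r c assume "r < dim_row (Y * mat_adjoint Y)" "c < dim_col (Y * mat_adjoint Y)"
    then have rc: "r < n * m" "c < n * m" using Y by auto
    have "(Y * mat_adjoint Y) $$ (r, c) = (\<Sum>i<n. Y $$ (r, i) * mat_adjoint Y $$ (i, c))"
      using rc Y by (intro index_mult_sum[of _ "n * m" n _ "n * m"]) auto
    also have "\<dots> = (\<Sum>i<n. if i = r div m then
      (if r div m = c div m then ?X $$ (r div m, r mod m) * cnj (?X $$ (c div m, c mod m)) else 0) else 0)"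
      using rc Y by (intro sum.cong) (auto simp: Y_def)
    also have "\<dots> = measured_state n m \<psi> $$ (r, c)"
      using rc by (simp add: index_measured_state less_mult_imp_div_less)
    finally show "measured_state n m \<psi> $$ (r, c) = (Y * mat_adjoint Y) $$ (r, c)" ..
  qed (use Y in \<open>auto simp: measured_state_def\<close>)
  moreover have "diag_part (?X * mat_adjoint ?X) = mat_adjoint Y * Y"
  proof (rule eq_matI)
    fix i j assume "i < dim_row (mat_adjoint Y * Y)" "j < dim_col (mat_adjoint Y * Y)"
    then have ij: "i < n" "j < n" using Y by auto
    have "(mat_adjoint Y * Y) $$ (i, j) = (\<Sum>r<n * m. mat_adjoint Y $$ (i, r) * Y $$ (r, j))"
      using ij Y by (intro index_mult_sum[of _ n "n * m" _ n]) auto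
    also have "\<dots> = (\<Sum>r<n * m. if r div m = i \<and> i = j then ?X $$ (i, r mod m) * cnj (?X $$ (i, r mod m)) else 0)"
      using ij Y by (intro sum.cong) (auto simp: Y_def)
    \<comment> \<open>The product index is grouped into \<open>n\<close> blocks of length
      \<open>m\<close>, one for each value of the \<open>Q\<close> part; only block \<open>i\<close>
      contributes.\<close>
    also have "\<dots> = (\<Sum>k<n. \<Sum>r=k*m..<k*m+m. if r div m = i \<and> i = j then ?X $$ (i, r mod m) * cnj (?X $$ (i, r mod m)) else 0)"
      by (rule sum.nat_group[symmetric])
    also have "\<dots> = (\<Sum>k<n. if k = i then
       (if i = j then \<Sum>l<m. ?X $$ (i, l) * cnj (?X $$ (i, l)) else 0) else 0)"
    proof (intro sum.cong refl)
      fix k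
      let ?f = "\<lambda>r. if r div m = i \<and> i = j then ?X $$ (i, r mod m) * cnj (?X $$ (i, r mod m)) else 0"
      have "(\<Sum>r=k*m..<k*m+m. ?f r) = (\<Sum>l<m. ?f (l + k * m))"
        using sum.shift_bounds_nat_ivl[of ?f 0 "k * m" m] by (simp add: add.commute atLeast0LessThan)
      also have "\<dots> = (\<Sum>l<m. if k = i \<and> i = j then ?X $$ (i, l) * cnj (?X $$ (i, l)) else 0)"
        by (intro sum.cong refl) simp
      finally have "(\<Sum>r=k*m..<k*m+m. ?f r) = \<dots>" .
      then show "(\<Sum>r=k*m..<k*m+m. if r div m = i \<and> i = j then ?X $$ (i, r mod m) * cnj (?X $$ (i, r mod m)) else 0)
        = (if k = i then (if i = j then \<Sum>l<m. ?X $$ (i, l) * cnj (?X $$ (i, l)) else 0) else 0)" by simp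
    qed
    also have "\<dots> = (if i = j then \<Sum>l<m. ?X $$ (i, l) * cnj (?X $$ (i, l)) else 0)"
      using ij by simp
    also have "(\<Sum>l<m. ?X $$ (i, l) * cnj (?X $$ (i, l))) = (\<Sum>l<m. ?X $$ (i, l) * mat_adjoint ?X $$ (l, i))"
      using ij by (intro sum.cong) (auto simp: coeff_mat_def)
    also have "\<dots> = (?X * mat_adjoint ?X) $$ (i, i)"
      using ij by (intro index_mult_sum[of _ n m _ n, symmetric]) auto
    finally show "diag_part (?X * mat_adjoint ?X) $$ (i, j) = (mat_adjoint Y * Y) $$ (i, j)"
      using ij by (auto simp: diag_part_def mat_diag_def coeff_mat_def)
  qed (use Y in \<open>auto simp: diag_part_def coeff_mat_def\<close>)
  ultimately show ?thesis using vn_entropy_mult_adjoint_commute[OF Y] by simp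
qed

text \<open>The joint entropy is that of the diagonal part, and the entropy of \<open>E\<close> is
  that of \<open>\<rho>\<close>. The value involves neither \<open>m\<close> nor
  \<open>\<psi>\<close>, as the definite description in \<open>randomness\<close> requires.\<close>

lemma cond_entropy_measured_purification:
  assumes "purification n m \<rho> \<psi>"
  shows "cond_entropy n m (measured_state n m \<psi>) = rel_entropy_coherence \<rho>"
proof -
  let ?X = "coeff_mat n m \<psi>"
  have \<rho>: "\<rho> = ?X * mat_adjoint ?X"
    using assms trace_out_E_ketbra unfolding purification_def by auto
  have "mat_adjoint (mat_adjoint ?X * ?X) = mat_adjoint ?X * ?X"
    using mat_adjoint_mult[of "mat_adjoint ?X" m n ?X m] by simp
  then have "vn_entropy (transpose_mat (mat_adjoint ?X * ?X)) = vn_entropy (mat_adjoint ?X * ?X)"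
    by (intro vn_entropy_transpose[of _ m]) (auto intro: mult_carrier_mat[of _ m n])
  also have "\<dots> = vn_entropy \<rho>"
    unfolding \<rho> using vn_entropy_mult_adjoint_commute[of ?X n m] by simp
  finally show ?thesis
    unfolding cond_entropy_def trace_out_Q_measured_state vn_entropy_measured_state
      rel_entropy_coherence_def \<rho>[symmetric] by simp
qed

text \<open>The coefficient matrix \<open>U * ?S\<close>, with \<open>?S\<close> the diagonal matrix
  of square roots of the eigenvalues, multiplied by its adjoint gives back \<open>\<rho>\<close>.
  The roots are real because positivity, tested on the eigenvector \<open>col U i\<close>, gives
  \<open>d i \<ge> 0\<close>.\<close>

lemma purification_exists:
  assumes "density_operator n \<rho>"
  shows "\<exists>\<psi>. purification n n \<rho> \<psi>"
proof -
  have \<rho>: "\<rho> \<in> carrier_mat n n" "mat_adjoint \<rho> = \<rho>"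
    and pos: "\<And>v. v \<in> carrier_vec n \<Longrightarrow> Re ((\<rho> *\<^sub>v v) \<bullet>c v) \<ge> 0"
    using assms unfolding density_operator_def by auto
  obtain U d where sd: "spectral_decomposition \<rho> U d"
    using hermitian_spectral_decomposition[OF \<rho>] by blast
  note U = spectral_decompositionD[OF sd \<rho>(1)]
  have d: "d i \<ge> 0" if i: "i < n" for i
  proof -
    have "\<rho> *\<^sub>v col U i = col (\<rho> * U) i" using \<rho> U(1) i by (auto intro!: eq_vecI)
    also have "\<dots> = complex_of_real (d i) \<cdot>\<^sub>v col U i"
      unfolding spectral_decomposition_mult(2)[OF sd \<rho>(1)] mat_diag_mult_right[OF U(1)]
      using U(1) i by (intro eq_vecI) auto
    finally have "(\<rho> *\<^sub>v col U i) \<bullet>c col U i = complex_of_real (d i) * (col U i \<bullet>c col U i)"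
      using U(1) i by (metis carrier_vec_conjugate col_carrier_vec smult_scalar_prod_distrib carrier_matD(2))
    also have "col U i \<bullet>c col U i = (mat_adjoint U * U) $$ (i, i)"
      using U(1) i by (auto simp: scalar_prod_def mult.commute intro!: sum.cong)
    also have "\<dots> = 1" unfolding U(3) using i by simp
    finally have "(\<rho> *\<^sub>v col U i) \<bullet>c col U i = complex_of_real (d i)" by simp
    with pos[of "col U i"] U(1) i show ?thesis by (metis Re_complex_of_real col_carrier_vec carrier_matD(2))
  qed
  define \<psi> where "\<psi> = vec (n * n) (\<lambda>r. U $$ (r div n, r mod n) * complex_of_real (sqrt (d (r mod n))))"
  have X: "coeff_mat n n \<psi> = U * mat_diag n (\<lambda>i. complex_of_real (sqrt (d i)))" (is "_ = U * ?S")
    unfolding mat_diag_mult_right[OF U(1)]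
    by (rule eq_matI) (auto simp: coeff_mat_def \<psi>_def product_index_less)
  have S_adj: "mat_adjoint ?S = ?S" by (rule eq_matI) (auto simp: mat_diag_def)
  have SS: "?S * ?S = mat_diag n (\<lambda>i. complex_of_real (d i))"
    unfolding mat_diag_diag using d by (intro eq_matI) (auto simp: mat_diag_def simp flip: of_real_mult)
  have "coeff_mat n n \<psi> * mat_adjoint (coeff_mat n n \<psi>) = U * (?S * ?S) * mat_adjoint U"
    unfolding X using mat_adjoint_mult[of U n n ?S n] U(1)
    by (simp add: mult_mat_assoc S_adj del: mat_diag_diag)
  also have "\<dots> = \<rho>" unfolding SS U(4)[symmetric] ..
  finally have \<psi>_\<rho>: "coeff_mat n n \<psi> * mat_adjoint (coeff_mat n n \<psi>) = \<rho>" .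
  have "\<psi> \<in> carrier_vec (n * n)" unfolding \<psi>_def by simp
  then have "purification n n \<rho> \<psi>"
    unfolding purification_def using trace_out_E_ketbra \<psi>_\<rho> by simp
  then show ?thesis ..
qed

lemma randomness_eq_coherence:
  assumes "density_operator n \<rho>"
  shows "randomness \<rho> = rel_entropy_coherence \<rho>"
proof -
  have n: "dim_row \<rho> = n" using assms unfolding density_operator_def by auto
  show ?thesis
    unfolding randomness_def n
    using purification_exists[OF assms] cond_entropy_measured_purification
    by (intro the_equality) (metis | blast)+
qed

section \<open>An entropy inequality\<close>

text \<open>At 0 the function is squeezed by \<open>2 * sqrt y\<close>, a bound that follows from
  \<open>ln z \<le> z\<close> at \<open>z = inverse (sqrt y)\<close>. Continuity at 0 is needed
  because an eigenvalue of a block may vanish at the end of the path considered below.\<close>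

lemma continuous_on_x_ln_x: "continuous_on {0..} (\<lambda>x::real. x * ln x)"
  unfolding continuous_on_eq_continuous_within
proof
  fix x :: real assume "x \<in> {0..}"
  show "continuous (at x within {0..}) (\<lambda>x. x * ln x)"
  proof (cases "x = 0")
    case False
    with \<open>x \<in> {0..}\<close> show ?thesis by (intro continuous_intros) auto
  next
    case True
    have bound: "norm (y * ln y) \<le> 2 * sqrt y" if y: "0 \<le> y" "y < 1" for y :: real
    proof (cases "y = 0")
      case False
      with y have y0: "y > 0" by simp
      have "ln (inverse (sqrt y)) \<le> inverse (sqrt y)"
        using ln_bound[of "inverse (sqrt y)"] y0 by simp
      then have "- ln y \<le> 2 * inverse (sqrt y)"
        using y0 by (simp add: ln_inverse ln_sqrt)
      then have "y * (- ln y) \<le> y * (2 * inverse (sqrt y))"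
        using y0 by (intro mult_left_mono) auto
      also have "\<dots> = 2 * sqrt y"
        using y0 by (simp add: field_simps)
      finally show ?thesis using y0 y ln_le_zero_iff[OF y0] by (simp add: abs_mult)
    qed simp
    have "((\<lambda>y::real. y * ln y) \<longlongrightarrow> 0) (at 0 within {0..})"
    proof (rule tendsto_0_le[where f = sqrt and K = 2])
      show "\<forall>\<^sub>F y::real in at 0 within {0..}. norm (y * ln y) \<le> norm (sqrt y) * 2"
        unfolding eventually_at using bound by (intro exI[of _ 1]) (auto simp: dist_real_def mult.commute[of "sqrt _"])
      have "isCont sqrt 0" by (rule isCont_real_sqrt)
      then show "(sqrt \<longlongrightarrow> 0) (at 0 within {0..})"
        unfolding isCont_def by (metis real_sqrt_zero subset_UNIV tendsto_within_subset)
    qed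
    then show ?thesis using True by (simp add: continuous_within)
  qed
qed

text \<open>\<open>artanh x / x\<close> is increasing, without divisions.\<close>

lemma ln_ratio_star_shaped:
  fixes k x w :: real
  assumes "0 \<le> x" "x \<le> w" "w < k"
  shows "w * (ln (k + x) - ln (k - x)) \<le> x * (ln (k + w) - ln (k - w))"
proof (cases "w = 0")
  case False
  with assms have w: "w > 0" by simp
  define \<theta> where "\<theta> = x / w"
  have \<theta>: "0 \<le> \<theta>" "\<theta> \<le> 1" "x = \<theta> * w" using assms w by (auto simp: \<theta>_def)
  \<comment> \<open>\<open>?D\<close> vanishes at 0. Its derivative is \<theta> times the difference
    of \<open>2 * k / (k\<^sup>2 - y\<^sup>2)\<close> at \<open>s\<close> and at
    \<open>\<theta> * s\<close>, which is nonnegative because that expression increases with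
    \<open>y\<close> on [0, k).\<close>
  let ?D = "\<lambda>s. \<theta> * (ln (k + s) - ln (k - s)) - (ln (k + \<theta> * s) - ln (k - \<theta> * s))"
  have "?D 0 \<le> ?D w"
  proof (rule DERIV_nonneg_imp_nondecreasing[where f = ?D])
    show "0 \<le> w" using w by simp
    fix s assume s: "0 \<le> s" "s \<le> w"
    have \<theta>s: "0 \<le> \<theta> * s" "\<theta> * s \<le> s" using \<theta> s by (auto intro: mult_left_le_one_le)
    have pos: "k + s > 0" "k - s > 0" "k + \<theta> * s > 0" "k - \<theta> * s > 0" using \<theta>s s assms by auto
    have "(?D has_real_derivative (\<theta> * (1 / (k + s) + 1 / (k - s)) - \<theta> * (1 / (k + \<theta> * s) + 1 / (k - \<theta> * s)))) (at s)"
    proof -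
      have L': "((\<lambda>y. ln (k + y) - ln (k - y)) has_real_derivative 1 / (k + y) + 1 / (k - y)) (at y)"
        if "k + y > 0" "k - y > 0" for y
        using that by (auto intro!: derivative_eq_intros simp: divide_inverse)
      have "((\<lambda>y. \<theta> * y) has_real_derivative \<theta>) (at s)" by (auto intro!: derivative_eq_intros)
      from DERIV_diff[OF DERIV_cmult[OF L'[OF pos(1,2)], of \<theta>] DERIV_chain2[OF L'[OF pos(3,4)] this]]
      show ?thesis by (simp add: mult.commute)
    qed
    moreover have "1 / (k + \<theta> * s) + 1 / (k - \<theta> * s) \<le> 1 / (k + s) + 1 / (k - s)"
    proof -
      have eq: "1 / (k + y) + 1 / (k - y) = 2 * k / (k\<^sup>2 - y\<^sup>2)" if "k + y > 0" "k - y > 0" for y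
        using that by (simp add: field_simps power2_eq_square)
      have "(\<theta> * s)\<^sup>2 \<le> s\<^sup>2" using \<theta>s by (intro power_mono) auto
      moreover have "s\<^sup>2 < k\<^sup>2" using s assms by (intro power_strict_mono) auto
      ultimately show ?thesis
        unfolding eq[OF pos(1,2)] eq[OF pos(3,4)] using s assms by (intro divide_left_mono) auto
    qed
    ultimately show "\<exists>y. (?D has_real_derivative y) (at s) \<and> 0 \<le> y"
      using \<theta>(1) by (intro exI[of _ "\<theta> * (1 / (k + s) + 1 / (k - s)) - \<theta> * (1 / (k + \<theta> * s) + 1 / (k - \<theta> * s))"])
        (auto intro: mult_left_mono)
  qed
  then have "ln (k + x) - ln (k - x) \<le> \<theta> * (ln (k + w) - ln (k - w))"
    using \<theta>(3) by simp
  then have "w * (ln (k + x) - ln (k - x)) \<le> w * (\<theta> * (ln (k + w) - ln (k - w)))"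
    using w by (intro mult_left_mono) auto
  then show ?thesis using \<theta>(3) by (simp add: mult_ac)
qed (use assms in auto)

text \<open>With \<open>k \<plusminus> u\<close> the diagonal and \<open>r + i v\<close> the off-diagonal entry of a Hermitian \<open>2 \<times> 2\<close> block, the
  inequality says that its coherence does not increase when \<open>u\<close> and \<open>v\<close> are replaced by 0. The proof
  follows the coherence of the blocks with \<open>t u\<close> and \<open>t v\<close> for \<open>t\<close> between 0 and 1.\<close>

lemma entropy_shift_inequality:
  fixes k u r v :: real
  defines "g \<equiv> \<lambda>x. (k + x) * ln (k + x) + (k - x) * ln (k - x)"
  assumes u: "0 \<le> u" and k: "u\<^sup>2 + r\<^sup>2 + v\<^sup>2 \<le> k\<^sup>2" "0 < k"
  shows "g u - g (sqrt (u\<^sup>2 + r\<^sup>2 + v\<^sup>2)) \<le> g 0 - g r"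
proof (cases "u\<^sup>2 + v\<^sup>2 = 0")
  case True
  then have "u = 0" "v = 0" by (auto simp: sum_power2_eq_zero_iff)
  then show ?thesis by (cases "r \<ge> 0") (auto simp: g_def)
next
  case False
  define M where "M = u\<^sup>2 + v\<^sup>2"
  have M: "M > 0" "u\<^sup>2 \<le> M" using False unfolding M_def by (auto simp: less_le)
  \<comment> \<open>Half the eigenvalue gap of the block with \<open>t * u\<close> and
    \<open>t * v\<close>. Then \<open>\<psi> t\<close> is its coherence in natural units, and the
    claim is \<open>\<psi> 0 \<le> \<psi> 1\<close>.\<close>
  define w where "w t = sqrt (r\<^sup>2 + t\<^sup>2 * M)" for t
  define \<psi> where "\<psi> t = g (w t) - g (u * t)" for t
  have kM: "r\<^sup>2 + M \<le> k\<^sup>2" using k(1) unfolding M_def by simp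
  have ut_w: "u * t \<le> w t" if "0 \<le> t" for t
  proof -
    have "(u * t)\<^sup>2 \<le> r\<^sup>2 + t\<^sup>2 * M"
      using mult_left_mono[OF M(2), of "t\<^sup>2"] by (simp add: power_mult_distrib mult.commute add_increasing)
    then show ?thesis unfolding w_def by (rule real_le_rsqrt)
  qed
  have w_nonneg: "0 \<le> w t" for t unfolding w_def using M by simp
  have w_le: "w t \<le> k" if "0 \<le> t" "t \<le> 1" for t
  proof -
    have "t\<^sup>2 * M \<le> 1 * M" using M that by (intro mult_right_mono) (auto simp: power_le_one)
    then have "r\<^sup>2 + t\<^sup>2 * M \<le> k\<^sup>2" using kM by simp
    then show ?thesis unfolding w_def using k(2) by (metis less_eq_real_def real_le_lsqrt)
  qed
  have "\<psi> 0 \<le> \<psi> 1"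
  \<comment> \<open>Differentiability is asked for on the open interval only: \<open>w\<close> may
    be 0 at \<open>t = 0\<close>, where the root is not smooth, and may reach \<open>k\<close> at
    \<open>t = 1\<close>, where \<open>ln (k - x)\<close> is singular.\<close>
  proof (rule DERIV_nonneg_imp_increasing_open[of 0 1])
    fix t :: real assume t: "0 < t" "t < 1"
    have "t\<^sup>2 < 1" using t by (simp add: power_less_one_iff)
    then have "r\<^sup>2 + t\<^sup>2 * M < k\<^sup>2" using mult_strict_right_mono[OF _ M(1), of "t\<^sup>2" 1] kM by simp
    then have wk: "w t < k" unfolding w_def using k(2) by (metis real_sqrt_less_mono real_sqrt_unique less_imp_le)
    have w0: "w t > 0" unfolding w_def using M t by (simp add: add_nonneg_pos)
    have ut: "0 \<le> u * t" "u * t \<le> w t" using u t ut_w by auto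
    let ?L = "\<lambda>x. ln (k + x) - ln (k - x)"
    have g': "(g has_real_derivative ?L x) (at x)" if "- k < x" "x < k" for x
    proof -
      have "k + x > 0" "k - x > 0" using that by auto
      then show ?thesis
        unfolding g_def by (auto intro!: derivative_eq_intros)
    qed
    have w': "(w has_real_derivative t * M / w t) (at t)"
      unfolding w_def using w0[unfolded w_def]
      by (auto intro!: derivative_eq_intros simp: field_simps)
    have "(\<psi> has_real_derivative ?L (w t) * (t * M / w t) - ?L (u * t) * u) (at t)"
      unfolding \<psi>_def
    proof (rule DERIV_diff)
      show "((\<lambda>x. g (w x)) has_real_derivative ?L (w t) * (t * M / w t)) (at t)"
        using DERIV_chain2[OF g' w'] wk w0 by simp
      have "((\<lambda>x. u * x) has_real_derivative u) (at t)" by (auto intro!: derivative_eq_intros)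
      then show "((\<lambda>x. g (u * x)) has_real_derivative ?L (u * t) * u) (at t)"
        using DERIV_chain2[OF g'] wk ut k(2) by simp
    qed
    moreover have "?L (u * t) * u \<le> ?L (w t) * (t * M / w t)"
    proof -
      have L0: "?L (w t) \<ge> 0" using wk w0 by simp
      \<comment> \<open>The star-shaped bound compares the slopes at \<open>u * t\<close> and
        \<open>w t\<close>; then \<open>u\<^sup>2 \<le> M\<close> makes the derivative of \<psi>
        nonnegative.\<close>
      have "w t * ?L (u * t) \<le> u * t * ?L (w t)"
        using ln_ratio_star_shaped[OF ut wk] .
      then have "w t * ?L (u * t) * u \<le> u * t * ?L (w t) * u"
        using u by (rule mult_right_mono)
      also have "\<dots> = u\<^sup>2 * (t * ?L (w t))" by (simp add: power2_eq_square)
      also have "\<dots> \<le> M * (t * ?L (w t))"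
        using M(2) L0 t by (intro mult_right_mono) auto
      finally show ?thesis using w0 by (simp add: field_simps)
    qed
    ultimately show "\<exists>y. (\<psi> has_real_derivative y) (at t) \<and> 0 \<le> y"
      by (intro exI conjI) auto
  next
    have g_cont: "continuous_on {-k..k} g"
      unfolding g_def
      by (intro continuous_on_add continuous_on_compose2[OF continuous_on_x_ln_x]) (auto intro!: continuous_intros)
    have "continuous_on {0..1} w" unfolding w_def by (intro continuous_intros)
    moreover have "w ` {0..1} \<subseteq> {-k..k}"
    proof
      fix x assume "x \<in> w ` {0..1}"
      then obtain t where t: "x = w t" "0 \<le> t" "t \<le> 1" by (metis atLeastAtMost_iff imageE)
      then show "x \<in> {-k..k}" using w_le[of t] w_nonneg[of t] k(2) by simp
    qed
    moreover have "(\<lambda>t. u * t) ` {0..1} \<subseteq> {-k..k}"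
    proof
      fix x assume "x \<in> (\<lambda>t. u * t) ` {0..1}"
      then obtain t where t: "x = u * t" "0 \<le> t" "t \<le> 1" by (metis atLeastAtMost_iff imageE)
      then show "x \<in> {-k..k}" using ut_w[of t] w_le[of t] k(2) mult_nonneg_nonneg[OF u t(2)] by simp
    qed
    ultimately show "continuous_on {0..1} \<psi>"
      unfolding \<psi>_def by (intro continuous_on_diff continuous_on_compose2[OF g_cont] continuous_intros) auto
  qed simp
  \<comment> \<open>Here \<open>w 0\<close> is the absolute value of \<open>r\<close>, and
    \<open>g\<close> is even.\<close>
  moreover have "g (w 0) = g r" unfolding w_def by (cases "r \<ge> 0") (auto simp: g_def)
  moreover have "w 1 = sqrt (u\<^sup>2 + r\<^sup>2 + v\<^sup>2)" unfolding w_def M_def by (simp add: add_ac)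
  ultimately show ?thesis unfolding \<psi>_def by simp
qed

section \<open>Hermitian blocks\<close>

lemma sum_lessThan_4: "(\<Sum>i<4. f i) = f 0 + f 1 + f 2 + f (3::nat)"
  by (simp add: eval_nat_numeral)

lemma sum_lessThan_2: "(\<Sum>i<2. f i) = f 0 + f (1::nat)"
  by (simp add: eval_nat_numeral)

lemma less_4_cases:
  fixes i :: nat
  assumes "i < 4"
  obtains "i = 0" | "i = 1" | "i = 2" | "i = 3"
  using assms by linarith

lemma less_2_cases:
  fixes i :: nat
  assumes "i < 2"
  obtains "i = 0" | "i = 1"
  using assms by linarith

text \<open>Keeps the index \<open>1\<close> from being rewritten to \<open>Suc 0\<close>, so that
  the entry lemmas below, stated with numerals, match.\<close>

declare One_nat_def [simp del]

text \<open>The direct sum of \<open>A\<close> on the span of \<open>|00\<rangle>, |11\<rangle>\<close> and \<open>B\<close> on the span of \<open>|01\<rangle>, |10\<rangle>\<close>.\<close>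

definition cross_mat :: "complex mat \<Rightarrow> complex mat \<Rightarrow> complex mat" where
  "cross_mat A B = mat_of_rows_list 4
     [[A $$ (0,0), 0, 0, A $$ (0,1)],
      [0, B $$ (0,0), B $$ (0,1), 0],
      [0, B $$ (1,0), B $$ (1,1), 0],
      [A $$ (1,0), 0, 0, A $$ (1,1)]]"

lemma cross_mat_carrier [simp]: "cross_mat A B \<in> carrier_mat 4 4"
  unfolding cross_mat_def mat_of_rows_list_def by (rule carrier_matI) simp_all

lemma dim_cross_mat [simp]: "dim_row (cross_mat A B) = 4" "dim_col (cross_mat A B) = 4"
  by (rule carrier_matD[OF cross_mat_carrier])+

lemma index_cross_mat:
  "cross_mat A B $$ (0,0) = A $$ (0,0)" "cross_mat A B $$ (0,1) = 0" "cross_mat A B $$ (0,2) = 0" "cross_mat A B $$ (0,3) = A $$ (0,1)"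
  "cross_mat A B $$ (1,0) = 0" "cross_mat A B $$ (1,1) = B $$ (0,0)" "cross_mat A B $$ (1,2) = B $$ (0,1)" "cross_mat A B $$ (1,3) = 0"
  "cross_mat A B $$ (2,0) = 0" "cross_mat A B $$ (2,1) = B $$ (1,0)" "cross_mat A B $$ (2,2) = B $$ (1,1)" "cross_mat A B $$ (2,3) = 0"
  "cross_mat A B $$ (3,0) = A $$ (1,0)" "cross_mat A B $$ (3,1) = 0" "cross_mat A B $$ (3,2) = 0" "cross_mat A B $$ (3,3) = A $$ (1,1)"
  by (simp_all add: cross_mat_def mat_of_rows_list_def)

lemma mat4_eqI:
  assumes "A \<in> carrier_mat 4 4" "B \<in> carrier_mat 4 4"
    "A $$ (0,0) = B $$ (0,0)" "A $$ (0,1) = B $$ (0,1)" "A $$ (0,2) = B $$ (0,2)" "A $$ (0,3) = B $$ (0,3)"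
    "A $$ (1,0) = B $$ (1,0)" "A $$ (1,1) = B $$ (1,1)" "A $$ (1,2) = B $$ (1,2)" "A $$ (1,3) = B $$ (1,3)"
    "A $$ (2,0) = B $$ (2,0)" "A $$ (2,1) = B $$ (2,1)" "A $$ (2,2) = B $$ (2,2)" "A $$ (2,3) = B $$ (2,3)"
    "A $$ (3,0) = B $$ (3,0)" "A $$ (3,1) = B $$ (3,1)" "A $$ (3,2) = B $$ (3,2)" "A $$ (3,3) = B $$ (3,3)"
  shows "A = B"
proof (rule eq_matI)
  fix i j assume "i < dim_row B" "j < dim_col B"
  then have "i < 4" "j < 4" using assms(2) by auto
  then show "A $$ (i, j) = B $$ (i, j)"
    by (elim less_4_cases; hypsubst; intro assms(3-))
qed (use assms(1,2) in auto)

lemma mat2_eqI: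
  assumes "A \<in> carrier_mat 2 2" "B \<in> carrier_mat 2 2"
    "A $$ (0,0) = B $$ (0,0)" "A $$ (0,1) = B $$ (0,1)" "A $$ (1,0) = B $$ (1,0)" "A $$ (1,1) = B $$ (1,1)"
  shows "A = B"
proof (rule eq_matI)
  fix i j assume "i < dim_row B" "j < dim_col B"
  then have "i < 2" "j < 2" using assms(2) by auto
  then show "A $$ (i, j) = B $$ (i, j)"
    by (elim less_2_cases; hypsubst; intro assms(3-))
qed (use assms(1,2) in auto)

lemma index_mult_mat_4:
  fixes A B :: "'a :: comm_semiring_0 mat"
  assumes "A \<in> carrier_mat 4 4" "B \<in> carrier_mat 4 4" "i < 4" "j < 4"
  shows "(A * B) $$ (i, j) = A $$ (i,0) * B $$ (0,j) + A $$ (i,1) * B $$ (1,j) + A $$ (i,2) * B $$ (2,j) + A $$ (i,3) * B $$ (3,j)"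
  unfolding index_mult_sum[OF assms] sum_lessThan_4 ..

lemma index_mult_mat_2:
  fixes A B :: "'a :: comm_semiring_0 mat"
  assumes "A \<in> carrier_mat 2 2" "B \<in> carrier_mat 2 2" "i < 2" "j < 2"
  shows "(A * B) $$ (i, j) = A $$ (i,0) * B $$ (0,j) + A $$ (i,1) * B $$ (1,j)"
  unfolding index_mult_sum[OF assms] sum_lessThan_2 ..

lemma cross_mat_mult:
  assumes "A \<in> carrier_mat 2 2" "B \<in> carrier_mat 2 2" "A' \<in> carrier_mat 2 2" "B' \<in> carrier_mat 2 2"
  shows "cross_mat A B * cross_mat A' B' = cross_mat (A * A') (B * B')"
  by (rule mat4_eqI)
    (use assms in \<open>simp_all add: mult_carrier_mat[OF cross_mat_carrier cross_mat_carrier] index_mult_mat_4 index_mult_mat_2 index_cross_mat del: index_mult_mat(1)\<close>)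

lemma mat_adjoint_cross_mat:
  assumes "A \<in> carrier_mat 2 2" "B \<in> carrier_mat 2 2"
  shows "mat_adjoint (cross_mat A B) = cross_mat (mat_adjoint A) (mat_adjoint B)"
  by (rule mat4_eqI) (use assms in \<open>simp_all add: index_cross_mat\<close>)

lemma cross_mat_one: "cross_mat (1\<^sub>m 2) (1\<^sub>m 2) = 1\<^sub>m 4"
  by (rule mat4_eqI) (simp_all add: index_cross_mat)

lemma vn_entropy_cross_mat:
  assumes A: "A \<in> carrier_mat 2 2" "mat_adjoint A = A" and B: "B \<in> carrier_mat 2 2" "mat_adjoint B = B"
  shows "vn_entropy (cross_mat A B) = vn_entropy A + vn_entropy B"
proof -
  obtain U d where sdA: "spectral_decomposition A U d"
    using hermitian_spectral_decomposition[OF A] by blast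
  obtain V e where sdB: "spectral_decomposition B V e"
    using hermitian_spectral_decomposition[OF B] by blast
  note U = spectral_decompositionD[OF sdA A(1)] and V = spectral_decompositionD[OF sdB B(1)]
  \<comment> \<open>The eigenvalues are listed in the positions of their blocks: those of
    \<open>A\<close> at 0 and 3, those of \<open>B\<close> at 1 and 2.\<close>
  let ?W = "cross_mat U V" and ?d = "\<lambda>i. [d 0, e 0, e 1, d 1] ! i"
  note adj = mat_adjoint_cross_mat[OF U(1) V(1)]
  have D: "mat_diag 4 (\<lambda>i. complex_of_real (?d i)) = cross_mat (mat_diag 2 (\<lambda>i. complex_of_real (d i))) (mat_diag 2 (\<lambda>i. complex_of_real (e i)))"
    by (rule mat4_eqI) (simp_all add: index_cross_mat mat_diag_def)
  have "spectral_decomposition (cross_mat A B) ?W ?d"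
  proof (rule spectral_decompositionI)
    show "?W * mat_adjoint ?W = 1\<^sub>m 4" "mat_adjoint ?W * ?W = 1\<^sub>m 4"
      using U(1) V(1) unfolding adj by (simp_all add: cross_mat_mult U(2,3) V(2,3) cross_mat_one)
    show "cross_mat A B = ?W * mat_diag 4 (\<lambda>i. complex_of_real (?d i)) * mat_adjoint ?W"
      unfolding D adj using U(1) V(1)
      by (simp add: cross_mat_mult mult_carrier_mat[of _ 2 2 _ 2] flip: U(4) V(4))
  qed auto
  then show ?thesis
    unfolding vn_entropy_eq[OF sdA A(1)] vn_entropy_eq[OF sdB B(1)]
    by (simp add: vn_entropy_eq[of _ ?W ?d 4] sum_lessThan_4 sum_lessThan_2)
qed

lemma diag_part_cross_mat:
  assumes "A \<in> carrier_mat 2 2" "B \<in> carrier_mat 2 2"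
  shows "diag_part (cross_mat A B) = cross_mat (diag_part A) (diag_part B)"
  by (rule mat4_eqI) (use assms in \<open>simp_all add: index_cross_mat diag_part_def mat_diag_def\<close>)

definition herm2 :: "real \<Rightarrow> real \<Rightarrow> complex \<Rightarrow> complex mat" where
  "herm2 a b c = mat_of_rows_list 2 [[complex_of_real a, c], [cnj c, complex_of_real b]]"

lemma herm2_carrier [simp]: "herm2 a b c \<in> carrier_mat 2 2"
  unfolding herm2_def mat_of_rows_list_def by (rule carrier_matI) simp_all

lemma dim_herm2 [simp]: "dim_row (herm2 a b c) = 2" "dim_col (herm2 a b c) = 2"
  by (rule carrier_matD[OF herm2_carrier])+

lemma index_herm2:
  "herm2 a b c $$ (0,0) = complex_of_real a" "herm2 a b c $$ (0,1) = c"
  "herm2 a b c $$ (1,0) = cnj c" "herm2 a b c $$ (1,1) = complex_of_real b"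
  by (simp_all add: herm2_def mat_of_rows_list_def)

lemma mat_adjoint_herm2 [simp]: "mat_adjoint (herm2 a b c) = herm2 a b c"
  by (rule mat2_eqI) (simp_all add: index_herm2)

lemma diag_part_herm2: "diag_part (herm2 a b c) = herm2 a b 0"
  by (rule mat2_eqI) (simp_all add: index_herm2 diag_part_def mat_diag_def)

text \<open>The traces of the matrix and of its square give the sum and the sum of squares of the
  two eigenvalues. This determines them up to order as \<open>k + R\<close> and
  \<open>k - R\<close>, without computing eigenvectors.\<close>

lemma vn_entropy_herm2:
  fixes a b :: real and c :: complex
  defines "k \<equiv> (a + b) / 2" and "R \<equiv> sqrt (((a - b) / 2)\<^sup>2 + (cmod c)\<^sup>2)"
  shows "vn_entropy (herm2 a b c) = - ((k + R) * log 2 (k + R) + (k - R) * log 2 (k - R))"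
proof -
  let ?A = "herm2 a b c"
  obtain U d where sd: "spectral_decomposition ?A U d"
    using hermitian_spectral_decomposition[OF herm2_carrier mat_adjoint_herm2] by blast
  note U = spectral_decompositionD[OF sd herm2_carrier]
  let ?D = "mat_diag 2 (\<lambda>i. complex_of_real (d i))"
  note dims = carrier_matD[OF U(1)]
  have "complex_of_real (a + b) = mat_trace ?A"
    by (simp add: mat_trace_def sum_lessThan_2 index_herm2)
  also have "\<dots> = complex_of_real (d 0 + d 1)"
    by (subst U(4)) (simp add: trace_unitary_conj_diag[OF U(1,3)] sum_lessThan_2)
  finally have tr: "d 0 + d 1 = a + b" unfolding of_real_eq_iff by simp
  have "complex_of_real (a\<^sup>2 + b\<^sup>2 + 2 * (cmod c)\<^sup>2) = mat_trace (?A * ?A)"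
    by (simp add: mat_trace_def sum_lessThan_2 index_herm2 index_mult_mat_2 complex_norm_square[symmetric]
        mult.commute[of "cnj c"] power2_eq_square del: index_mult_mat(1))
  also have "?A * ?A = ?A * U * ?D * mat_adjoint U"
    using arg_cong[OF U(4), of "\<lambda>M. ?A * M"] by (simp add: mult_mat_assoc dims)
  also have "\<dots> = U * (?D * ?D) * mat_adjoint U"
    unfolding spectral_decomposition_mult(2)[OF sd herm2_carrier]
    by (simp add: mult_mat_assoc dims del: mat_diag_diag)
  also have "mat_trace \<dots> = complex_of_real ((d 0)\<^sup>2 + (d 1)\<^sup>2)"
    unfolding mat_diag_diag trace_unitary_conj_diag[OF U(1,3)] by (simp add: sum_lessThan_2 power2_eq_square)
  finally have tr2: "(d 0)\<^sup>2 + (d 1)\<^sup>2 = a\<^sup>2 + b\<^sup>2 + 2 * (cmod c)\<^sup>2" unfolding of_real_eq_iff by simp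
  have R: "R \<ge> 0" "R\<^sup>2 = ((a - b) / 2)\<^sup>2 + (cmod c)\<^sup>2" unfolding R_def by auto
  have "(d 0 - k)\<^sup>2 = R\<^sup>2"
  proof -
    have d1: "d 1 = a + b - d 0" using tr by simp
    show ?thesis using tr2 unfolding R(2) k_def d1 by (simp add: power2_eq_square field_simps)
  qed
  then have "d 0 - k = R \<or> d 0 - k = - R" by (simp add: power2_eq_iff)
  then have "d 0 = k + R \<and> d 1 = k - R \<or> d 0 = k - R \<and> d 1 = k + R"
  proof
    assume "d 0 - k = R"
    then have "d 0 = k + R" "d 1 = k - R" using tr by (auto simp: k_def field_simps)
    then show ?thesis by simp
  next
    assume "d 0 - k = - R"
    then have "d 0 = k - R" "d 1 = k + R" using tr by (auto simp: k_def field_simps)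
    then show ?thesis by simp
  qed
  then show ?thesis
    unfolding vn_entropy_eq[OF sd herm2_carrier] by (auto simp: sum_lessThan_2)
qed

text \<open>The coherence of the block \<open>herm2 a b c\<close>, whose eigenvalues are
  \<open>k + R\<close> and \<open>k - R\<close>. The trace of the block is arbitrary, so that
  unnormalized blocks are covered.\<close>

definition coherence2 :: "real \<Rightarrow> real \<Rightarrow> complex \<Rightarrow> real" where
  "coherence2 a b c = (let k = (a + b) / 2; R = sqrt (((a - b) / 2)\<^sup>2 + (cmod c)\<^sup>2) in
     (k + R) * log 2 (k + R) + (k - R) * log 2 (k - R) - a * log 2 a - b * log 2 b)"

lemma rel_entropy_coherence_cross_mat:
  "rel_entropy_coherence (cross_mat (herm2 a b c) (herm2 d g f)) = coherence2 a b c + coherence2 d g f"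
proof -
  have diag: "vn_entropy (herm2 a b 0) = - (a * log 2 a + b * log 2 b)" for a b
  proof -
    \<comment> \<open>For a diagonal block the formula for the eigenvalues returns the diagonal
      entries, in decreasing order.\<close>
    have "(a + b) / 2 + \<bar>a - b\<bar> / 2 = max a b" "(a + b) / 2 - \<bar>a - b\<bar> / 2 = min a b"
      by (auto simp: field_simps max_def min_def abs_if)
    then show ?thesis unfolding vn_entropy_herm2 by (simp add: abs_divide max_def min_def)
  qed
  show ?thesis
    unfolding rel_entropy_coherence_def
    by (simp add: diag_part_cross_mat diag_part_herm2 vn_entropy_cross_mat diag)
      (simp add: vn_entropy_herm2 coherence2_def Let_def)
qed

section \<open>Positivity and principal two-by-two minors\<close>

lemma quadratic_form_sum:
  fixes A :: "complex mat"
  assumes "A \<in> carrier_mat n n" "v \<in> carrier_vec n"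
  shows "(A *\<^sub>v v) \<bullet>c v = (\<Sum>i<n. (\<Sum>j<n. A $$ (i, j) * v $ j) * cnj (v $ i))"
  using assms by (simp add: scalar_prod_def atLeast0LessThan)

lemma density_operator_hermitian:
  assumes "density_operator n \<rho>" "i < n" "j < n"
  shows "\<rho> $$ (i, j) = cnj (\<rho> $$ (j, i))"
proof -
  have "\<rho> \<in> carrier_mat n n" "mat_adjoint \<rho> = \<rho>" using assms(1) unfolding density_operator_def by auto
  then show ?thesis using index_mat_adjoint[of i \<rho> j] assms(2,3) by auto
qed

lemma density_operator_diag_real:
  assumes "density_operator n \<rho>" "i < n"
  shows "\<rho> $$ (i, i) = complex_of_real (Re (\<rho> $$ (i, i)))"
  using density_operator_hermitian[OF assms assms(2)] by (metis Reals_cnj_iff of_real_Re)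

lemma density_operator_two_level_form:
  assumes \<rho>: "density_operator n \<rho>" and ij: "i < n" "j < n" "i \<noteq> j"
  shows "0 \<le> Re (\<rho> $$ (i, i)) * (cmod x)\<^sup>2 + Re (\<rho> $$ (j, j)) * (cmod y)\<^sup>2 + 2 * Re (\<rho> $$ (i, j) * y * cnj x)"
proof -
  have carr: "\<rho> \<in> carrier_mat n n" using \<rho> unfolding density_operator_def by auto
  define v where "v = vec n (\<lambda>k. if k = i then x else if k = j then y else 0)"
  have v: "v \<in> carrier_vec n" "v $ i = x" "v $ j = y" "\<And>k. k < n \<Longrightarrow> k \<notin> {i, j} \<Longrightarrow> v $ k = 0"
    using ij unfolding v_def by auto
  have "(\<rho> *\<^sub>v v) \<bullet>c v = (\<Sum>k<n. (\<Sum>l\<in>{i,j}. \<rho> $$ (k, l) * v $ l) * cnj (v $ k))"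
    unfolding quadratic_form_sum[OF carr v(1)]
    using ij v(4) by (intro sum.cong refl arg_cong2[where f = "(*)"] sum.mono_neutral_right) auto
  also have "\<dots> = (\<Sum>k\<in>{i,j}. (\<Sum>l\<in>{i,j}. \<rho> $$ (k, l) * v $ l) * cnj (v $ k))"
    using ij v(4) by (intro sum.mono_neutral_right) auto
  also have "\<dots> = \<rho> $$ (i, i) * (x * cnj x) + \<rho> $$ (j, j) * (y * cnj y)
      + (\<rho> $$ (i, j) * y * cnj x + \<rho> $$ (j, i) * x * cnj y)"
    using ij(3) v(2,3) by (simp add: algebra_simps)
  also have "\<rho> $$ (j, i) * x * cnj y = cnj (\<rho> $$ (i, j) * y * cnj x)"
    using density_operator_hermitian[OF \<rho> ij(2,1)] by simp
  finally have "Re ((\<rho> *\<^sub>v v) \<bullet>c v) = Re (\<rho> $$ (i, i)) * (cmod x)\<^sup>2 + Re (\<rho> $$ (j, j)) * (cmod y)\<^sup>2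
      + 2 * Re (\<rho> $$ (i, j) * y * cnj x)"
    unfolding complex_norm_square[symmetric] by (simp add: algebra_simps)
  then show ?thesis using \<rho> v(1) unfolding density_operator_def by metis
qed

text \<open>The form at \<open>x = c\<close> and \<open>y = - t\<close> becomes the real quadratic
  \<open>a * C + b * t\<^sup>2 - 2 * t * C\<close>, to be nonnegative for all \<open>t\<close>. For
  \<open>a \<noteq> 0\<close> the choice \<open>t = a\<close> gives the determinant bound.\<close>

lemma density_operator_minor:
  assumes \<rho>: "density_operator n \<rho>" and ij: "i < n" "j < n" "i \<noteq> j"
  shows "0 \<le> Re (\<rho> $$ (i, i))" "0 \<le> Re (\<rho> $$ (j, j))"
    "(cmod (\<rho> $$ (i, j)))\<^sup>2 \<le> Re (\<rho> $$ (i, i)) * Re (\<rho> $$ (j, j))"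
proof -
  define a b c where "a = Re (\<rho> $$ (i, i))" and "b = Re (\<rho> $$ (j, j))" and "c = \<rho> $$ (i, j)"
  note form = density_operator_two_level_form[OF assms, folded a_def b_def c_def]
  have a: "0 \<le> a" using form[of 1 0] by simp
  have b: "0 \<le> b" using form[of 0 1] by simp
  define C where "C = (cmod c)\<^sup>2"
  have cc: "Re (c * - complex_of_real t * cnj c) = - t * C" for t
    unfolding C_def by (simp add: cmod_power2) (simp add: power2_eq_square algebra_simps)
  have q: "0 \<le> a * C + b * t\<^sup>2 - 2 * t * C" for t
    using form[of c "- complex_of_real t"] unfolding cc by (simp add: C_def)
  have "C \<le> a * b"
  proof (cases "a = 0")
    case True
    \<comment> \<open>With \<open>a = 0\<close> a small positive \<open>t\<close> forces
      \<open>C = 0\<close>; the denominator \<open>b + 1\<close> covers \<open>b = 0\<close> as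
      well.\<close>
    have "0 \<le> b * (C / (b + 1))\<^sup>2 - 2 * (C / (b + 1)) * C" using q[of "C / (b + 1)"] True by simp
    also have "\<dots> = C\<^sup>2 * (- b - 2) / (b + 1)\<^sup>2"
      using b by (simp add: divide_simps power2_eq_square) (simp add: algebra_simps)
    finally have "0 \<le> C\<^sup>2 * (- b - 2)" using b by (simp add: zero_le_divide_iff)
    then have "C = 0" using b by (simp add: zero_le_mult_iff)
    then show ?thesis using a b by simp
  next
    case False
    have "0 \<le> a * (a * b - C)" using q[of a] by (simp add: power2_eq_square algebra_simps)
    then show ?thesis using False a by (simp add: zero_le_mult_iff)
  qed
  then show "0 \<le> Re (\<rho> $$ (i, i))" "0 \<le> Re (\<rho> $$ (j, j))"
    "(cmod (\<rho> $$ (i, j)))\<^sup>2 \<le> Re (\<rho> $$ (i, i)) * Re (\<rho> $$ (j, j))"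
    using a b unfolding a_def b_def c_def C_def by auto
qed

text \<open>The cross term is at most twice \<open>sqrt a * sqrt b * cmod x * cmod y\<close> in
  absolute value, so the form dominates the square of
  \<open>sqrt a * cmod x - sqrt b * cmod y\<close>.\<close>

lemma two_level_form_nonneg:
  fixes x y c :: complex
  assumes "0 \<le> a" "0 \<le> b" "(cmod c)\<^sup>2 \<le> a * b"
  shows "0 \<le> a * (cmod x)\<^sup>2 + b * (cmod y)\<^sup>2 + 2 * Re (c * y * cnj x)"
proof -
  have "cmod c \<le> sqrt a * sqrt b"
    using assms by (simp add: real_le_rsqrt flip: real_sqrt_mult)
  then have "cmod c * (cmod y * cmod x) \<le> (sqrt a * sqrt b) * (cmod y * cmod x)"
    by (intro mult_right_mono) auto
  moreover have "\<bar>Re (c * y * cnj x)\<bar> \<le> cmod c * (cmod y * cmod x)"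
    using abs_Re_le_cmod[of "c * y * cnj x"] by (simp add: norm_mult mult.assoc)
  moreover have "0 \<le> (sqrt a * cmod x - sqrt b * cmod y)\<^sup>2" by simp
  moreover have "(sqrt a * cmod x - sqrt b * cmod y)\<^sup>2
      = a * (cmod x)\<^sup>2 + b * (cmod y)\<^sup>2 - 2 * ((sqrt a * sqrt b) * (cmod y * cmod x))"
    using assms(1,2) by (simp add: power2_diff power_mult_distrib)
  ultimately show ?thesis by linarith
qed

text \<open>The quadratic form is the sum of one two-level form for each block. This supplies both
  the normalized conditional states and the minimizer.\<close>

lemma density_operator_cross_mat:
  assumes "0 \<le> a" "0 \<le> b" "(cmod c)\<^sup>2 \<le> a * b" "0 \<le> d" "0 \<le> g" "(cmod f)\<^sup>2 \<le> d * g"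
    and "a + b + d + g = 1"
  shows "density_operator 4 (cross_mat (herm2 a b c) (herm2 d g f))" (is "density_operator 4 ?\<rho>")
  unfolding density_operator_def
proof (intro conjI ballI)
  show "mat_adjoint ?\<rho> = ?\<rho>" by (simp add: mat_adjoint_cross_mat)
  show "mat_trace ?\<rho> = 1"
    using assms(7) by (simp add: mat_trace_def sum_lessThan_4 index_cross_mat index_herm2 add_ac flip: of_real_add)
  fix v :: "complex vec" assume v: "v \<in> carrier_vec 4"
  have "(?\<rho> *\<^sub>v v) \<bullet>c v
      = complex_of_real a * (v $ 0 * cnj (v $ 0)) + complex_of_real b * (v $ 3 * cnj (v $ 3))
        + (c * v $ 3 * cnj (v $ 0) + cnj (c * v $ 3 * cnj (v $ 0)))
        + (complex_of_real d * (v $ 1 * cnj (v $ 1)) + complex_of_real g * (v $ 2 * cnj (v $ 2))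
        + (f * v $ 2 * cnj (v $ 1) + cnj (f * v $ 2 * cnj (v $ 1))))"
    unfolding quadratic_form_sum[OF cross_mat_carrier v] sum_lessThan_4
    by (simp add: index_cross_mat index_herm2 algebra_simps)
  then have "Re ((?\<rho> *\<^sub>v v) \<bullet>c v)
      = (a * (cmod (v $ 0))\<^sup>2 + b * (cmod (v $ 3))\<^sup>2 + 2 * Re (c * v $ 3 * cnj (v $ 0)))
        + (d * (cmod (v $ 1))\<^sup>2 + g * (cmod (v $ 2))\<^sup>2 + 2 * Re (f * v $ 2 * cnj (v $ 1)))"
    unfolding complex_norm_square[symmetric] by (simp add: algebra_simps)
  then show "0 \<le> Re ((?\<rho> *\<^sub>v v) \<bullet>c v)"
    using two_level_form_nonneg[OF assms(1-3), of "v $ 0" "v $ 3"]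
      two_level_form_nonneg[OF assms(4-6), of "v $ 1" "v $ 2"] by simp
qed simp

section \<open>Projectors, bit flip and Bell vectors in coordinates\<close>

lemma Pi_plus_eq: "Pi_plus = cross_mat (herm2 1 1 0) (herm2 0 0 0)"
  by (rule mat4_eqI)
    (simp_all add: index_cross_mat index_herm2 Pi_plus_def ketbra_def tensor_vec_def ket0_def ket1_def)

lemma Pi_minus_eq: "Pi_minus = cross_mat (herm2 0 0 0) (herm2 1 1 0)"
  by (rule mat4_eqI)
    (simp_all add: index_cross_mat index_herm2 Pi_minus_def ketbra_def tensor_vec_def ket0_def ket1_def)

lemma inv_sqrt2_mult [simp]: "inv_sqrt2 * inv_sqrt2 = 1 / 2" "cnj inv_sqrt2 = inv_sqrt2"
  by (simp_all add: inv_sqrt2_def flip: of_real_mult)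

lemma Pi_x_minus_eq: "Pi_x_minus = cross_mat (herm2 (1/2) (1/2) (- 1/2)) (herm2 (1/2) (1/2) (- 1/2))"
  by (rule mat4_eqI)
    (simp_all add: index_cross_mat index_herm2 Pi_x_minus_def ketbra_def tensor_vec_def ket0_def ket1_def
       ket_plus_def ket_minus_def)

lemma index_ket_i_tensor:
  "tensor_vec ket_plus_i ket_plus_i $ 0 = 1/2" "tensor_vec ket_plus_i ket_plus_i $ 1 = \<i>/2"
  "tensor_vec ket_plus_i ket_plus_i $ 2 = \<i>/2" "tensor_vec ket_plus_i ket_plus_i $ 3 = - 1/2"
  "tensor_vec ket_minus_i ket_minus_i $ 0 = 1/2" "tensor_vec ket_minus_i ket_minus_i $ 1 = - \<i>/2"
  "tensor_vec ket_minus_i ket_minus_i $ 2 = - \<i>/2" "tensor_vec ket_minus_i ket_minus_i $ 3 = - 1/2"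
  "dim_vec (tensor_vec ket_plus_i ket_plus_i) = 4" "dim_vec (tensor_vec ket_minus_i ket_minus_i) = 4"
proof -
  have k: "ket_plus_i $ 0 = inv_sqrt2" "ket_plus_i $ 1 = inv_sqrt2 * \<i>"
    "ket_minus_i $ 0 = inv_sqrt2" "ket_minus_i $ 1 = - (inv_sqrt2 * \<i>)"
    "dim_vec ket_plus_i = 2" "dim_vec ket_minus_i = 2"
    by (simp_all add: ket_plus_i_def ket_minus_i_def ket0_def ket1_def)
  have m: "inv_sqrt2 * (inv_sqrt2 * z) = z / 2" "inv_sqrt2 * z * inv_sqrt2 = z / 2"
    "inv_sqrt2 * z * (inv_sqrt2 * y) = z * y / 2" for y z
    by (simp_all add: mult.left_commute[of z] mult.assoc[symmetric] mult.commute[of z])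
  show "tensor_vec ket_plus_i ket_plus_i $ 0 = 1/2" "tensor_vec ket_plus_i ket_plus_i $ 1 = \<i>/2"
    "tensor_vec ket_plus_i ket_plus_i $ 2 = \<i>/2" "tensor_vec ket_plus_i ket_plus_i $ 3 = - 1/2"
    "tensor_vec ket_minus_i ket_minus_i $ 0 = 1/2" "tensor_vec ket_minus_i ket_minus_i $ 1 = - \<i>/2"
    "tensor_vec ket_minus_i ket_minus_i $ 2 = - \<i>/2" "tensor_vec ket_minus_i ket_minus_i $ 3 = - 1/2"
    "dim_vec (tensor_vec ket_plus_i ket_plus_i) = 4" "dim_vec (tensor_vec ket_minus_i ket_minus_i) = 4"
    by (simp_all add: tensor_vec_def k m)
qed

text \<open>Compared with \<open>Pi_x_minus\<close> only the off-diagonal sign of the second block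
  changes, so the two error rates together determine the real parts of both off-diagonal
  entries.\<close>

lemma Pi_y_minus_eq: "Pi_y_minus = cross_mat (herm2 (1/2) (1/2) (- 1/2)) (herm2 (1/2) (1/2) (1/2))"
  by (rule mat4_eqI)
    (simp_all add: index_cross_mat index_herm2 Pi_y_minus_def ketbra_def index_ket_i_tensor)

lemma bit_flip_B_eq:
  "bit_flip_B = mat_of_rows_list 4 [[0, 1, 0, 0], [1, 0, 0, 0], [0, 0, 0, 1], [0, 0, 1, 0]]"
proof (rule mat4_eqI)
  show "bit_flip_B \<in> carrier_mat 4 4"
    by (rule carrier_matI) (simp_all add: bit_flip_B_def tensor_mat_def mat_of_rows_list_def)
  show "mat_of_rows_list 4 [[0, 1, 0, 0], [1, 0, 0, 0], [0, 0, 0, 1], [0, 0, 1, 0]] \<in> carrier_mat 4 4"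
    by (rule carrier_matI) (simp_all add: mat_of_rows_list_def)
qed (simp_all add: bit_flip_B_def tensor_mat_def mat_of_rows_list_def numeral_2_eq_2[symmetric])

lemma bell_basis_carrier: "i < 4 \<Longrightarrow> bell_basis ! i \<in> carrier_vec 4"
  by (elim less_4_cases; rule carrier_vecI)
    (simp_all add: bell_basis_def bell_Phi_plus_def bell_Phi_minus_def bell_Psi_plus_def bell_Psi_minus_def
      tensor_vec_def ket0_def ket1_def)

lemma index_bell_basis:
  "bell_basis ! 0 $ 0 = inv_sqrt2" "bell_basis ! 0 $ 1 = 0" "bell_basis ! 0 $ 2 = 0" "bell_basis ! 0 $ 3 = inv_sqrt2"
  "bell_basis ! 1 $ 0 = inv_sqrt2" "bell_basis ! 1 $ 1 = 0" "bell_basis ! 1 $ 2 = 0" "bell_basis ! 1 $ 3 = - inv_sqrt2"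
  "bell_basis ! 2 $ 0 = 0" "bell_basis ! 2 $ 1 = inv_sqrt2" "bell_basis ! 2 $ 2 = inv_sqrt2" "bell_basis ! 2 $ 3 = 0"
  "bell_basis ! 3 $ 0 = 0" "bell_basis ! 3 $ 1 = inv_sqrt2" "bell_basis ! 3 $ 2 = - inv_sqrt2" "bell_basis ! 3 $ 3 = 0"
  by (simp_all add: bell_basis_def bell_Phi_plus_def bell_Phi_minus_def bell_Psi_plus_def bell_Psi_minus_def
      tensor_vec_def ket0_def ket1_def)

section \<open>The six-state protocol\<close>

lemma coherence2_zero [simp]: "coherence2 0 0 0 = 0"
  by (simp add: coherence2_def)

text \<open>Each term \<open>x * log 2 x\<close> picks up a multiple of \<open>log 2 s\<close>, and
  these cancel because the eigenvalues and the diagonal entries have the same sum. The determinant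
  bound gives \<open>R \<le> k\<close>, so no logarithm has a negative argument.\<close>

lemma coherence2_scale:
  assumes s: "0 < s" and ab: "0 \<le> a" "0 \<le> b" "(cmod c)\<^sup>2 \<le> a * b"
  shows "s * coherence2 (a / s) (b / s) (c / complex_of_real s) = coherence2 a b c"
proof -
  define k R where "k = (a + b) / 2" and "R = sqrt (((a - b) / 2)\<^sup>2 + (cmod c)\<^sup>2)"
  have "((a - b) / 2)\<^sup>2 + (cmod c)\<^sup>2 \<le> k\<^sup>2"
    using ab(3) unfolding k_def by (simp add: power2_eq_square field_simps)
  moreover have "0 \<le> k" using ab(1,2) by (simp add: k_def)
  ultimately have R: "0 \<le> R" "R \<le> k"
    unfolding R_def by (simp_all add: real_le_lsqrt)
  have ks: "(a / s + b / s) / 2 = k / s" using s by (simp add: k_def field_simps)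
  have "((a / s - b / s) / 2)\<^sup>2 + (cmod (c / complex_of_real s))\<^sup>2
      = (((a - b) / 2)\<^sup>2 + (cmod c)\<^sup>2) / s\<^sup>2"
    using s by (simp add: norm_divide power2_eq_square field_simps)
  then have Rs: "sqrt (((a / s - b / s) / 2)\<^sup>2 + (cmod (c / complex_of_real s))\<^sup>2) = R / s"
    using s by (simp add: R_def real_sqrt_divide)
  have xl: "s * (x / s * log 2 (x / s)) = x * log 2 x - x * log 2 s" if "0 \<le> x" for x
    using that s by (cases "x = 0") (auto simp: log_divide field_simps)
  have "s * coherence2 (a / s) (b / s) (c / complex_of_real s)
      = s * ((k + R) / s * log 2 ((k + R) / s)) + s * ((k - R) / s * log 2 ((k - R) / s))
        - s * (a / s * log 2 (a / s)) - s * (b / s * log 2 (b / s))"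
    unfolding coherence2_def Let_def ks Rs by (simp only: add_divide_distrib diff_divide_distrib ring_distribs)
  also have "\<dots> = (k + R) * log 2 (k + R) + (k - R) * log 2 (k - R) - a * log 2 a - b * log 2 b"
    using R ab(1,2) by (simp only: xl) (simp add: k_def field_simps)
  finally show ?thesis unfolding coherence2_def Let_def k_def R_def .
qed

lemma coherence2_symmetric:
  "coherence2 k k (complex_of_real r) = (k + r) * log 2 (k + r) + (k - r) * log 2 (k - r) - 2 * (k * log 2 k)"
  unfolding coherence2_def Let_def by (cases "0 \<le> r") auto

text \<open>An instance of \<open>entropy_shift_inequality\<close> with half the diagonal difference
  as \<open>u\<close> and the imaginary part of \<open>c\<close> as \<open>v\<close>. A block of
  trace zero vanishes and is treated apart, since that inequality requires
  \<open>k > 0\<close>.\<close>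

lemma coherence2_ge_symmetric:
  assumes ab: "0 \<le> a" "0 \<le> b" "(cmod c)\<^sup>2 \<le> a * b"
  shows "coherence2 ((a + b) / 2) ((a + b) / 2) (complex_of_real (Re c)) \<le> coherence2 a b c"
proof (cases "a + b = 0")
  case True
  then have "a = 0" "b = 0" using ab by auto
  then show ?thesis using ab(3) by simp
next
  case False
  define k u where "k = (a + b) / 2" and "u = \<bar>a - b\<bar> / 2"
  have k: "0 < k" using False ab unfolding k_def by simp
  have u2: "u\<^sup>2 = ((a - b) / 2)\<^sup>2" by (simp add: u_def power_divide)
  define R where "R = sqrt (((a - b) / 2)\<^sup>2 + (cmod c)\<^sup>2)"
  have R: "R = sqrt (u\<^sup>2 + (Re c)\<^sup>2 + (Im c)\<^sup>2)"
    unfolding R_def u2 cmod_power2 by (simp add: add.assoc)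
  let ?g = "\<lambda>x. (k + x) * ln (k + x) + (k - x) * ln (k - x)"
  have "u\<^sup>2 + (Re c)\<^sup>2 + (Im c)\<^sup>2 \<le> k\<^sup>2"
    using ab(3) unfolding u2 k_def cmod_power2 by (simp add: power2_eq_square field_simps)
  from entropy_shift_inequality[OF _ this k]
  have ineq: "?g u - ?g R \<le> ?g 0 - ?g (Re c)" unfolding R by (simp add: u_def)
  have gu: "?g u = a * ln a + b * ln b"
  proof -
    have "k + u = max a b" "k - u = min a b"
      unfolding k_def u_def by (auto simp: field_simps max_def min_def abs_if)
    then show ?thesis by (simp add: max_def min_def)
  qed
  have "coherence2 a b c = (?g R - ?g u) / ln 2"
    unfolding gu coherence2_def Let_def k_def[symmetric] R_def[symmetric] log_def by (simp add: field_simps)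
  moreover have "coherence2 k k (complex_of_real (Re c)) = (?g (Re c) - ?g 0) / ln 2"
    unfolding coherence2_symmetric log_def by (simp add: field_simps)
  ultimately show ?thesis
    using ineq unfolding k_def[symmetric] by (simp add: divide_right_mono)
qed

text \<open>Names exactly the entries that survive in \<open>Phi_map\<close>. The error rates, the
  Bell-basis diagonal and the key rate depend on the state through these alone.\<close>

locale two_qubit_entries =
  fixes \<rho> :: "complex mat" and a b d g :: real and c f :: complex
  assumes carrier: "\<rho> \<in> carrier_mat 4 4"
    and entries: "\<rho> $$ (0,0) = complex_of_real a" "\<rho> $$ (3,3) = complex_of_real b"
      "\<rho> $$ (0,3) = c" "\<rho> $$ (3,0) = cnj c"
      "\<rho> $$ (1,1) = complex_of_real d" "\<rho> $$ (2,2) = complex_of_real g"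
      "\<rho> $$ (1,2) = f" "\<rho> $$ (2,1) = cnj f"
begin

lemma dims: "dim_row \<rho> = 4" "dim_col \<rho> = 4"
  using carrier by auto

lemma Pi_plus_sandwich: "Pi_plus * \<rho> * Pi_plus = cross_mat (herm2 a b c) (herm2 0 0 0)"
  unfolding Pi_plus_eq
  by (rule mat4_eqI)
    (simp_all add: carrier index_mult_mat_4 mult_carrier_mat[of _ 4 4 _ 4] index_cross_mat index_herm2 entries
      del: index_mult_mat(1))

lemma Pi_minus_sandwich: "Pi_minus * \<rho> * Pi_minus = cross_mat (herm2 0 0 0) (herm2 d g f)"
  unfolding Pi_minus_eq
  by (rule mat4_eqI)
    (simp_all add: carrier index_mult_mat_4 mult_carrier_mat[of _ 4 4 _ 4] index_cross_mat index_herm2 entries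
      del: index_mult_mat(1))

lemma Phi_map_eq: "Phi_map \<rho> = cross_mat (herm2 a b c) (herm2 d g f)"
  unfolding Phi_map_def Pi_plus_sandwich Pi_minus_sandwich
  by (rule mat4_eqI) (simp_all add: index_cross_mat index_herm2)

lemma trace_eq: "mat_trace \<rho> = complex_of_real (a + b + d + g)"
  by (simp add: mat_trace_def dims sum_lessThan_4 entries)

lemma traces:
  "mat_trace (Pi_plus * \<rho>) = complex_of_real (a + b)"
  "mat_trace (Pi_minus * \<rho>) = complex_of_real (d + g)"
  "mat_trace (Pi_x_minus * \<rho>) = complex_of_real ((a + b + d + g) / 2 - Re c - Re f)"
  "mat_trace (Pi_y_minus * \<rho>) = complex_of_real ((a + b + d + g) / 2 - Re c + Re f)"
proof -
  \<comment> \<open>All four operators are direct sums of Hermitian blocks, so each trace is an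
    instance of one pairing of entries.\<close>
  have tr: "mat_trace (cross_mat (herm2 a' b' c') (herm2 d' g' f') * \<rho>)
      = complex_of_real (a' * a + b' * b + d' * d + g' * g + 2 * Re (c' * cnj c) + 2 * Re (f' * cnj f))"
    for a' b' c' d' g' f'
    by (simp add: mat_trace_def dims sum_lessThan_4 index_mult_mat_4 carrier index_cross_mat index_herm2 entries
        del: index_mult_mat(1)) (simp add: complex_eq_iff)
  show "mat_trace (Pi_plus * \<rho>) = complex_of_real (a + b)"
    "mat_trace (Pi_minus * \<rho>) = complex_of_real (d + g)"
    "mat_trace (Pi_x_minus * \<rho>) = complex_of_real ((a + b + d + g) / 2 - Re c - Re f)"
    "mat_trace (Pi_y_minus * \<rho>) = complex_of_real ((a + b + d + g) / 2 - Re c + Re f)"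
    unfolding Pi_plus_eq Pi_minus_eq Pi_x_minus_eq Pi_y_minus_eq tr of_real_eq_iff
    by (simp_all add: field_simps)
qed

lemma bell_diag_eq:
  "bell_diag \<rho> 0 = (a + b) / 2 + Re c" "bell_diag \<rho> 1 = (a + b) / 2 - Re c"
  "bell_diag \<rho> 2 = (d + g) / 2 + Re f" "bell_diag \<rho> 3 = (d + g) / 2 - Re f"
proof -
  have m: "Re inv_sqrt2 * (Re inv_sqrt2 * x) = x / 2" "Im inv_sqrt2 = 0" for x
    by (simp_all add: inv_sqrt2_def)
  show "bell_diag \<rho> 0 = (a + b) / 2 + Re c" "bell_diag \<rho> 1 = (a + b) / 2 - Re c"
    "bell_diag \<rho> 2 = (d + g) / 2 + Re f" "bell_diag \<rho> 3 = (d + g) / 2 - Re f"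
    unfolding bell_diag_def
    by (simp_all add: quadratic_form_sum[OF carrier bell_basis_carrier] sum_lessThan_4 index_bell_basis entries
        ring_distribs m field_simps)
qed

lemma coherence_Phi_map: "rel_entropy_coherence (Phi_map \<rho>) = coherence2 a b c + coherence2 d g f"
  unfolding Phi_map_eq rel_entropy_coherence_cross_mat ..

end

text \<open>The flip exchanges the indices 0 and 1 as well as 2 and 3, which moves the odd-parity
  block to the even-parity position. Both conditional states then have the same shape.\<close>

lemma bit_flip_B_sandwich:
  "bit_flip_B * cross_mat (herm2 0 0 0) (herm2 d g f) * bit_flip_B = cross_mat (herm2 d g f) (herm2 0 0 0)"
proof -
  have c: "bit_flip_B \<in> carrier_mat 4 4"
    by (rule carrier_matI) (simp_all add: bit_flip_B_eq mat_of_rows_list_def)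
  have i: "bit_flip_B $$ (0,0) = 0" "bit_flip_B $$ (0,1) = 1" "bit_flip_B $$ (0,2) = 0" "bit_flip_B $$ (0,3) = 0"
    "bit_flip_B $$ (1,0) = 1" "bit_flip_B $$ (1,1) = 0" "bit_flip_B $$ (1,2) = 0" "bit_flip_B $$ (1,3) = 0"
    "bit_flip_B $$ (2,0) = 0" "bit_flip_B $$ (2,1) = 0" "bit_flip_B $$ (2,2) = 0" "bit_flip_B $$ (2,3) = 1"
    "bit_flip_B $$ (3,0) = 0" "bit_flip_B $$ (3,1) = 0" "bit_flip_B $$ (3,2) = 1" "bit_flip_B $$ (3,3) = 0"
    by (simp_all add: bit_flip_B_eq mat_of_rows_list_def)
  show ?thesis
    by (rule mat4_eqI)
      (simp_all add: c i index_mult_mat_4 mult_carrier_mat[of _ 4 4 _ 4] index_cross_mat index_herm2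
        del: index_mult_mat(1))
qed

text \<open>For positive weight this is homogeneity of the coherence. For weight zero the argument
  of \<open>randomness\<close> is not a state, but the factor \<open>s\<close> makes the left side 0
  and the block itself vanishes.\<close>

lemma randomness_single_block:
  assumes ab: "0 \<le> a" "0 \<le> b" "(cmod c)\<^sup>2 \<le> a * b" and s: "s = a + b"
  shows "s * randomness (cross_mat (herm2 (a / s) (b / s) (c / complex_of_real s)) (herm2 0 0 0)) = coherence2 a b c"
proof (cases "s = 0")
  case True
  then have "a = 0" "b = 0" using ab s by auto
  then show ?thesis using ab(3) True by simp
next
  case False
  then have s0: "0 < s" using ab s by simp
  have "density_operator 4 (cross_mat (herm2 (a / s) (b / s) (c / complex_of_real s)) (herm2 0 0 0))"
  proof (rule density_operator_cross_mat)
    show "(cmod (c / complex_of_real s))\<^sup>2 \<le> a / s * (b / s)"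
      using ab(3) s0 by (simp add: norm_divide power2_eq_square divide_right_mono)
    show "a / s + b / s + 0 + 0 = 1" using s s0 by (simp add: add_divide_distrib[symmetric])
  qed (use ab s0 in auto)
  then show ?thesis
    using coherence2_scale[OF s0 ab] by (simp add: randomness_eq_coherence rel_entropy_coherence_cross_mat)
qed

lemma (in two_qubit_entries) key_randomness_eq:
  assumes ab: "0 \<le> a" "0 \<le> b" "(cmod c)\<^sup>2 \<le> a * b"
    and dg: "0 \<le> d" "0 \<le> g" "(cmod f)\<^sup>2 \<le> d * g" and e: "1 - e = a + b" "e = d + g"
  shows "key_randomness e \<rho> = rel_entropy_coherence (Phi_map \<rho>)"
proof -
  \<comment> \<open>This includes \<open>s = 0\<close>, where division by zero gives the zero matrix
    on both sides.\<close>
  have scale: "(1 / complex_of_real s) \<cdot>\<^sub>m cross_mat (herm2 a b c) (herm2 d g f)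
      = cross_mat (herm2 (a / s) (b / s) (c / complex_of_real s)) (herm2 (d / s) (g / s) (f / complex_of_real s))"
    for s a b c d g f
    by (rule mat4_eqI) (simp_all add: index_cross_mat index_herm2)
  have plus: "post_state Pi_plus \<rho>
      = cross_mat (herm2 (a / (1 - e)) (b / (1 - e)) (c / complex_of_real (1 - e))) (herm2 0 0 0)"
    unfolding post_state_def traces Pi_plus_sandwich e(1)[symmetric] scale by (simp only: div_0)
  have minus: "post_state Pi_minus \<rho>
      = cross_mat (herm2 0 0 0) (herm2 (d / e) (g / e) (f / complex_of_real e))"
    unfolding post_state_def traces Pi_minus_sandwich e(2)[symmetric] scale by (simp only: div_0)
  show ?thesis
    unfolding key_randomness_def plus minus bit_flip_B_sandwich coherence_Phi_map
    unfolding randomness_single_block[OF ab e(1)] randomness_single_block[OF dg e(2)] ..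
qed

lemma density_operator_entries:
  assumes \<rho>: "density_operator 4 \<rho>"
  obtains a b c d g f where "two_qubit_entries \<rho> a b d g c f"
    "0 \<le> a" "0 \<le> b" "(cmod c)\<^sup>2 \<le> a * b" "0 \<le> d" "0 \<le> g" "(cmod f)\<^sup>2 \<le> d * g" "a + b + d + g = 1"
proof -
  have "two_qubit_entries \<rho> (Re (\<rho> $$ (0,0))) (Re (\<rho> $$ (3,3))) (Re (\<rho> $$ (1,1))) (Re (\<rho> $$ (2,2)))
     (\<rho> $$ (0,3)) (\<rho> $$ (1,2))"
  proof (intro two_qubit_entries.intro refl)
    show "\<rho> \<in> carrier_mat 4 4" using \<rho> unfolding density_operator_def by blast
  qed (rule density_operator_diag_real[OF \<rho>] density_operator_hermitian[OF \<rho>]; simp)+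
  moreover have "Re (\<rho> $$ (0,0)) + Re (\<rho> $$ (3,3)) + Re (\<rho> $$ (1,1)) + Re (\<rho> $$ (2,2)) = 1"
  proof -
    have "mat_trace \<rho> = 1" using \<rho> unfolding density_operator_def by blast
    then show ?thesis
      unfolding two_qubit_entries.trace_eq[OF calculation] of_real_eq_1_iff .
  qed
  ultimately show thesis
    using density_operator_minor[OF \<rho>, of 0 3] density_operator_minor[OF \<rho>, of 1 2] by (intro that) auto
qed

text \<open>\<open>LEAST\<close> over the reals yields the minimum once a minimizer is exhibited;
  existence of the minimum and its value are obtained together.\<close>

lemma min_over_attained:
  assumes "x \<in> A" "\<And>y. y \<in> A \<Longrightarrow> f x \<le> f y"
  shows "is_arg_min f (\<lambda>y. y \<in> A) x" "min_over f A = f x"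
proof -
  show "is_arg_min f (\<lambda>y. y \<in> A) x" using assms by (auto simp: is_arg_min_linorder)
  show "min_over f A = f x" unfolding min_over_def using assms by (intro Least_equality) auto
qed

theorem corollary2:
  fixes e\<^sub>x e\<^sub>y e\<^sub>z e\<^sub>b :: real and S :: "complex mat set"
  assumes "S = six_state_set e\<^sub>x e\<^sub>y e\<^sub>z"
    and "S \<noteq> {}"
    and "e\<^sub>b = e\<^sub>z"
  shows "(\<exists>\<rho>. is_arg_min (key_randomness e\<^sub>b) (\<lambda>\<rho>. \<rho> \<in> S) \<rho>)
    \<and> (\<exists>\<rho>. is_arg_min (\<lambda>\<rho>. rel_entropy_coherence (Phi_map \<rho>)) (\<lambda>\<rho>. \<rho> \<in> S) \<rho>)
    \<and> symmetric_key_rate S e\<^sub>b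
        = min_over (\<lambda>\<rho>. rel_entropy_coherence (Phi_map \<rho>)) S - binary_entropy e\<^sub>b
    \<and> (\<forall>\<rho>\<in>S.
        (\<forall>p. (\<Sum>i<4. p i) = 1 \<and> e\<^sub>x = p 1 + p 3 \<and> e\<^sub>y = p 1 + p 2 \<and> e\<^sub>z = p 2 + p 3
              \<longleftrightarrow> (\<forall>i<4. p i = bell_diag \<rho> i))
        \<and> symmetric_key_rate S e\<^sub>b = 1 - shannon_entropy 4 (bell_diag \<rho>))"
proof -
  \<comment> \<open>Half the traces of the two blocks and the real parts of their off-diagonal
    entries, found by solving the equations for the error rates.\<close>
  define k l r q where "k = (1 - e\<^sub>z) / 2" and "l = e\<^sub>z / 2" and "r = (1 - e\<^sub>x - e\<^sub>y) / 2" and "q = (e\<^sub>y - e\<^sub>x) / 2"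
  define V where "V = coherence2 k k (complex_of_real r) + coherence2 l l (complex_of_real q)"
  have entries: "\<exists>a b c d g f. two_qubit_entries \<rho> a b d g c f \<and> 0 \<le> a \<and> 0 \<le> b \<and> (cmod c)\<^sup>2 \<le> a * b
      \<and> 0 \<le> d \<and> 0 \<le> g \<and> (cmod f)\<^sup>2 \<le> d * g \<and> a + b = 2 * k \<and> d + g = 2 * l \<and> Re c = r \<and> Re f = q"
    if "\<rho> \<in> S" for \<rho>
  proof -
    have \<rho>: "density_operator 4 \<rho>" "mat_trace (Pi_x_minus * \<rho>) = complex_of_real e\<^sub>x"
      "mat_trace (Pi_y_minus * \<rho>) = complex_of_real e\<^sub>y" "mat_trace (Pi_minus * \<rho>) = complex_of_real e\<^sub>z"
      using that unfolding assms(1) six_state_set_def by auto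
    obtain a b c d g f where ent: "two_qubit_entries \<rho> a b d g c f"
      and pos: "0 \<le> a" "0 \<le> b" "(cmod c)\<^sup>2 \<le> a * b" "0 \<le> d" "0 \<le> g" "(cmod f)\<^sup>2 \<le> d * g" "a + b + d + g = 1"
      by (rule density_operator_entries[OF \<rho>(1)])
    interpret two_qubit_entries \<rho> a b d g c f by (rule ent)
    have "e\<^sub>z = d + g" "e\<^sub>x = 1 / 2 - Re c - Re f" "e\<^sub>y = 1 / 2 - Re c + Re f"
      using \<rho>(2-4) pos(7) unfolding traces of_real_eq_iff by simp_all
    then have "a + b = 2 * k \<and> d + g = 2 * l \<and> Re c = r \<and> Re f = q"
      using pos(7) by (simp add: k_def l_def r_def q_def)
    then show ?thesis
      using ent pos(1-6)
      by (intro exI[of _ a] exI[of _ b] exI[of _ c] exI[of _ d] exI[of _ g] exI[of _ f]) simp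
  qed
  have coherence_eq: "key_randomness e\<^sub>b \<rho> = rel_entropy_coherence (Phi_map \<rho>)" if \<rho>S: "\<rho> \<in> S" for \<rho>
  proof -
    obtain a b c d g f where ent: "two_qubit_entries \<rho> a b d g c f"
      "0 \<le> a" "0 \<le> b" "(cmod c)\<^sup>2 \<le> a * b" "0 \<le> d" "0 \<le> g" "(cmod f)\<^sup>2 \<le> d * g" "a + b = 2 * k" "d + g = 2 * l"
      using entries[OF \<rho>S] by blast
    show ?thesis
      using two_qubit_entries.key_randomness_eq[OF ent(1-7)] ent(8,9) assms(3) by (simp add: k_def l_def)
  qed
  have lower: "V \<le> rel_entropy_coherence (Phi_map \<rho>)" if \<rho>S: "\<rho> \<in> S" for \<rho>
  proof -
    obtain a b c d g f where ent: "two_qubit_entries \<rho> a b d g c f"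
      "0 \<le> a" "0 \<le> b" "(cmod c)\<^sup>2 \<le> a * b" "0 \<le> d" "0 \<le> g" "(cmod f)\<^sup>2 \<le> d * g" "a + b = 2 * k" "d + g = 2 * l"
      "Re c = r" "Re f = q"
      using entries[OF \<rho>S] by blast
    show ?thesis
      unfolding two_qubit_entries.coherence_Phi_map[OF ent(1)] V_def
      using coherence2_ge_symmetric[OF ent(2-4)] coherence2_ge_symmetric[OF ent(5-7)] ent(8-) by simp
  qed
  \<comment> \<open>The Bell-diagonal state with the prescribed weights, which attains the lower
    bound \<open>V\<close>.\<close>
  define \<rho>0 where "\<rho>0 = cross_mat (herm2 k k (complex_of_real r)) (herm2 l l (complex_of_real q))"
  have ent0: "two_qubit_entries \<rho>0 k k l l (complex_of_real r) (complex_of_real q)"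
    by unfold_locales (simp_all add: \<rho>0_def index_cross_mat index_herm2)
  have \<rho>0: "\<rho>0 \<in> S"
  proof -
    obtain \<rho> where "\<rho> \<in> S" using assms(2) by auto
    from entries[OF this] obtain a b c d g f where pos: "0 \<le> a" "0 \<le> b" "(cmod c)\<^sup>2 \<le> a * b"
      "0 \<le> d" "0 \<le> g" "(cmod f)\<^sup>2 \<le> d * g" and eq: "a + b = 2 * k" "d + g = 2 * l" "Re c = r" "Re f = q" by blast
    \<comment> \<open>Nonemptiness of \<open>S\<close> provides a state whose positivity passes to
      \<open>\<rho>0\<close>: the squared real part is at most \<open>x * y\<close>, hence at most
      the square of the mean.\<close>
    have AMGM: "(Re z)\<^sup>2 \<le> m * m" if "(cmod z)\<^sup>2 \<le> x * y" "x + y = 2 * m" for z and x y m :: real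
    proof -
      have "(Re z)\<^sup>2 \<le> x * y" using that(1) unfolding cmod_power2 by (smt (verit) zero_le_power2)
      also have "\<dots> \<le> ((x + y) / 2)\<^sup>2"
        using zero_le_power2[of "x - y"] by (simp add: power2_eq_square field_simps)
      finally show ?thesis using that(2) by (simp add: power2_eq_square)
    qed
    have "density_operator 4 \<rho>0"
      unfolding \<rho>0_def using pos eq AMGM[OF pos(3) eq(1)] AMGM[OF pos(6) eq(2)]
      by (intro density_operator_cross_mat) (auto simp: k_def l_def)
    then show ?thesis
      unfolding assms(1) six_state_set_def
      by (simp add: two_qubit_entries.traces[OF ent0]) (simp add: k_def l_def r_def q_def field_simps)
  qed
  have V0: "rel_entropy_coherence (Phi_map \<rho>0) = V"
    unfolding two_qubit_entries.coherence_Phi_map[OF ent0] V_def ..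
  have min_coh: "is_arg_min (\<lambda>\<rho>. rel_entropy_coherence (Phi_map \<rho>)) (\<lambda>\<rho>. \<rho> \<in> S) \<rho>0"
    "min_over (\<lambda>\<rho>. rel_entropy_coherence (Phi_map \<rho>)) S = V"
    using min_over_attained[OF \<rho>0, of "\<lambda>\<rho>. rel_entropy_coherence (Phi_map \<rho>)"] lower V0 by simp_all
  have min_key: "is_arg_min (key_randomness e\<^sub>b) (\<lambda>\<rho>. \<rho> \<in> S) \<rho>0" "min_over (key_randomness e\<^sub>b) S = V"
    using min_over_attained[OF \<rho>0, of "key_randomness e\<^sub>b"] lower V0 by (simp_all add: coherence_eq \<rho>0)
  have rate: "symmetric_key_rate S e\<^sub>b = V - binary_entropy e\<^sub>b"
    unfolding symmetric_key_rate_def min_key(2) ..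
  \<comment> \<open>Turns the diagonal terms of \<open>V\<close>, with entries
    \<open>(1 - e\<^sub>z) / 2\<close> and \<open>e\<^sub>z / 2\<close> each occurring twice, into
    \<open>1 + binary_entropy e\<^sub>z\<close>; the binary entropy then cancels against the
    reconciliation cost.\<close>
  have half: "2 * (x / 2 * log 2 (x / 2)) = x * log 2 x - x" if "0 \<le> x" for x :: real
    using that by (cases "x = 0") (auto simp: log_divide field_simps)
  have "(\<forall>p. (\<Sum>i<4. p i) = 1 \<and> e\<^sub>x = p 1 + p 3 \<and> e\<^sub>y = p 1 + p 2 \<and> e\<^sub>z = p 2 + p 3
              \<longleftrightarrow> (\<forall>i<4. p i = bell_diag \<rho> i))
        \<and> symmetric_key_rate S e\<^sub>b = 1 - shannon_entropy 4 (bell_diag \<rho>)" if \<rho>: "\<rho> \<in> S" for \<rho>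
  proof -
    obtain a b c d g f where ent: "two_qubit_entries \<rho> a b d g c f"
      and pos: "0 \<le> a" "0 \<le> b" "0 \<le> d" "0 \<le> g"
      and eq: "a + b = 2 * k" "d + g = 2 * l" "Re c = r" "Re f = q"
      using entries[OF \<rho>] by blast
    have bell: "bell_diag \<rho> 0 = k + r" "bell_diag \<rho> 1 = k - r" "bell_diag \<rho> 2 = l + q" "bell_diag \<rho> 3 = l - q"
      unfolding two_qubit_entries.bell_diag_eq[OF ent] eq by simp_all
    have all4: "(\<forall>i<4. P i) \<longleftrightarrow> P 0 \<and> P 1 \<and> P 2 \<and> P (3::nat)" for P
    proof -
      have "i < 4 \<longleftrightarrow> i = 0 \<or> i = 1 \<or> i = 2 \<or> i = 3" for i :: nat by arith
      then show ?thesis by auto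
    qed
    have p: "(\<Sum>i<4. p i) = 1 \<and> e\<^sub>x = p 1 + p 3 \<and> e\<^sub>y = p 1 + p 2 \<and> e\<^sub>z = p 2 + p 3
        \<longleftrightarrow> (\<forall>i<4. p i = bell_diag \<rho> i)" for p :: "nat \<Rightarrow> real"
      unfolding all4 bell sum_lessThan_4 k_def l_def r_def q_def by (auto simp: field_simps)
    have "0 \<le> 1 - e\<^sub>z" "0 \<le> e\<^sub>z" using pos eq(1,2) by (auto simp: k_def l_def)
    then have "V = 1 + binary_entropy e\<^sub>z - shannon_entropy 4 (bell_diag \<rho>)"
      unfolding V_def coherence2_symmetric shannon_entropy_def sum_lessThan_4 bell binary_entropy_def
      using half[of "1 - e\<^sub>z"] half[of "e\<^sub>z"] by (simp add: k_def[symmetric] l_def[symmetric])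
    then show ?thesis using p rate assms(3) by simp
  qed
  then show ?thesis using min_coh min_key rate by auto
qed

end
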